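(* Let $k$ be a field of characteristic different from $2$ and $3$, let $a,d\in k$ be distinct and non-zero, and let $E: ax^2+y^2=1+dx^2y^2$. Let $P=(x,y)\in E(\overline{k})\setminus\{(0,1),(0,-1)\}$ and let $n\ge1$ be an integer. Then $P$ is an $n$-torsion point of $E$ if and only if $\psi_n(P)=0$.
   Context: The function field $k(E)$ is the field of fractions of $k[x,y]/(ax^2+y^2-1-dx^2y^2)$. Define elements $\psi_n=\psi_n(x,y)$ of $k(E)$ recursively for $n\ge 0$ by $\psi_0=0$, $\psi_1=1$, $\psi_2=\dfrac{(a-d)(1+y)}{x(2(1-y))}$, $\psi_3=\dfrac{(a-d)^3(a+2ay-2dy^3-dy^4)}{(2(1-y))^4}$, $\psi_4=\dfrac{2(a-d)^6y(1+y)(a-dy^4)}{x(2(1-y))^7}$, $\psi_{2m+1}=\psi_{m+2}\psi_m^3-\psi_{m-1}\psi_{m+1}^3$ for $m\ge 2$, $\psi_{2m}=\dfrac{\psi_m}{\psi_2}\left(\psi_{m+2}\psi_{m-1}^2-\psi_{m-2}\psi_{m+1}^2\right)$ for $m\ge 3$. These functions are regular at every point of $E(\overline{k})\setminus\{(0,1),(0,-1)\}$, and $\psi_n(P)$ is the value at $P$ of the function-field element $\psi_n$. Group law: points on $E$ are added by $(x_1,y_1)+(x_2,y_2)=\left(\frac{x_1y_2+x_2y_1}{1+dx_1x_2y_1y_2},\frac{y_1y_2-ax_1x_2}{1-dx_1x_2y_1y_2}\right)$, with identity $(0,1)$ and $-(x,y)=(-x,y)$. This corresponds to the group law of the elliptic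 curve $W: v^2=u^3-\frac{a^2+14ad+d^2}{48}u-\frac{a^3-33a^2d-33ad^2+d^3}{864}$ with identity $\mathcal{O}$ (point at infinity) under the map $(x,y)\mapsto(u,v)$, $u=\frac{(5a-d)+(a-5d)y}{12(1-y)}$, $v=\frac{(a-d)(1+y)}{4x(1-y)}$ if $x(1-y)\ne0$, $(0,1)\mapsto\mathcal{O}$, $(0,-1)\mapsto\left(\frac{a+d}{6},0\right)$. A point $P\in E(\overline{k})$ is an $n$-torsion point if $[n]P=(0,1)$ (its order divides $n$), meaning that the $n$-th multiple of its image in $W(\overline{k})$ is $\mathcal{O}$. *)

theory Defs
  imports "HOL-Algebra.Algebra" "HOL-Algebra.Algebraic_Closure_Type"
begin

section \<open>The field of fractions of a domain\<close>

definition frac_rel :: "('a, 'b) ring_scheme \<Rightarrow> (('a \<times> 'a) \<times> ('a \<times> 'a)) set" where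
  "frac_rel R = {((a, b), (c, e)). a \<in> carrier R \<and> b \<in> carrier R - {\<zero>\<^bsub>R\<^esub>} \<and>
     c \<in> carrier R \<and> e \<in> carrier R - {\<zero>\<^bsub>R\<^esub>} \<and> a \<otimes>\<^bsub>R\<^esub> e = c \<otimes>\<^bsub>R\<^esub> b}"

definition frac_class :: "('a, 'b) ring_scheme \<Rightarrow> 'a \<Rightarrow> 'a \<Rightarrow> ('a \<times> 'a) set" where
  "frac_class R a b = frac_rel R `` {(a, b)}"

definition fraction_field :: "('a, 'b) ring_scheme \<Rightarrow> ('a \<times> 'a) set ring" where
  "fraction_field R =
    \<lparr>carrier = (carrier R \<times> (carrier R - {\<zero>\<^bsub>R\<^esub>})) // frac_rel R,
     monoid.mult = (\<lambda>A B. \<Union>(a, b)\<in>A. \<Union>(c, e)\<in>B. frac_class R (a \<otimes>\<^bsub>R\<^esub> c) (b \<otimes>\<^bsub>R\<^esub> e)),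
     one = frac_class R \<one>\<^bsub>R\<^esub> \<one>\<^bsub>R\<^esub>,
     ring.zero = frac_class R \<zero>\<^bsub>R\<^esub> \<one>\<^bsub>R\<^esub>,
     add = (\<lambda>A B. \<Union>(a, b)\<in>A. \<Union>(c, e)\<in>B.
       frac_class R (a \<otimes>\<^bsub>R\<^esub> e \<oplus>\<^bsub>R\<^esub> c \<otimes>\<^bsub>R\<^esub> b) (b \<otimes>\<^bsub>R\<^esub> e))\<rparr>"


section \<open>The function field of a twisted Edwards curve\<close>

text \<open>The polynomial ring $k[x,y]$ is the type of polynomials in $y$ whose coefficients are
  polynomials in $x$.\<close>

definition polyC :: "'k::field \<Rightarrow> 'k poly poly" where
  "polyC c = [:[:c:]:]"

definition polyX :: "'k::field poly poly" where
  "polyX = [:[:0, 1:]:]"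

definition polyY :: "'k::field poly poly" where
  "polyY = [:0, 1:]"

definition edwards_poly :: "'k::field \<Rightarrow> 'k \<Rightarrow> 'k poly poly" where
  "edwards_poly a d = polyC a * polyX^2 + polyY^2 - 1 - polyC d * polyX^2 * polyY^2"

definition edwards_ideal :: "'k::field \<Rightarrow> 'k \<Rightarrow> 'k poly poly set" where
  "edwards_ideal a d = Idl\<^bsub>ring_of_type_algebra\<^esub> {edwards_poly a d}"

definition coord_ring :: "'k::field \<Rightarrow> 'k \<Rightarrow> 'k poly poly set ring" where
  "coord_ring a d = ring_of_type_algebra Quot edwards_ideal a d"

definition function_field ::
    "'k::field \<Rightarrow> 'k \<Rightarrow> ('k poly poly set \<times> 'k poly poly set) set ring" where
  "function_field a d = fraction_field (coord_ring a d)"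

text \<open>The element of the function field represented by $p/q$; it is meaningful only if
  \<open>q\<close> is not in \<open>edwards_ideal a d\<close>.\<close>

definition ff_quot ::
    "'k::field \<Rightarrow> 'k \<Rightarrow> 'k poly poly \<Rightarrow> 'k poly poly \<Rightarrow> ('k poly poly set \<times> 'k poly poly set) set" where
  "ff_quot a d p q = frac_class (coord_ring a d)
     (edwards_ideal a d +>\<^bsub>ring_of_type_algebra\<^esub> p) (edwards_ideal a d +>\<^bsub>ring_of_type_algebra\<^esub> q)"

function psi :: "'k::field \<Rightarrow> 'k \<Rightarrow> nat \<Rightarrow> ('k poly poly set \<times> 'k poly poly set) set" where
  "psi a d 0 = \<zero>\<^bsub>function_field a d\<^esub>"
| "psi a d 1 = \<one>\<^bsub>function_field a d\<^esub>"
| "psi a d 2 = ff_quot a d (polyC (a - d) * (1 + polyY)) (polyX * (2 * (1 - polyY)))"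
| "psi a d 3 = ff_quot a d
     (polyC (a - d)^3 *
        (polyC a + 2 * polyC a * polyY - 2 * polyC d * polyY^3 - polyC d * polyY^4))
     ((2 * (1 - polyY))^4)"
| "psi a d 4 = ff_quot a d
     (2 * polyC (a - d)^6 * polyY * (1 + polyY) * (polyC a - polyC d * polyY^4))
     (polyX * (2 * (1 - polyY))^7)"
| "m \<ge> 2 \<Longrightarrow> psi a d (2 * m + 1) =
     psi a d (m + 2) \<otimes>\<^bsub>function_field a d\<^esub> psi a d m [^]\<^bsub>function_field a d\<^esub> (3::nat)
     \<ominus>\<^bsub>function_field a d\<^esub>
     psi a d (m - 1) \<otimes>\<^bsub>function_field a d\<^esub> psi a d (m + 1) [^]\<^bsub>function_field a d\<^esub> (3::nat)"
| "m \<ge> 3 \<Longrightarrow> psi a d (2 * m) =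
     (psi a d m \<otimes>\<^bsub>function_field a d\<^esub> inv\<^bsub>function_field a d\<^esub> psi a d 2) \<otimes>\<^bsub>function_field a d\<^esub>
     (psi a d (m + 2) \<otimes>\<^bsub>function_field a d\<^esub> psi a d (m - 1) [^]\<^bsub>function_field a d\<^esub> (2::nat)
      \<ominus>\<^bsub>function_field a d\<^esub>
      psi a d (m - 2) \<otimes>\<^bsub>function_field a d\<^esub> psi a d (m + 1) [^]\<^bsub>function_field a d\<^esub> (2::nat))"
proof (atomize_elim, goal_cases)
  case (1 x)
  obtain a d n where x: "x = (a, d, n)" by (cases x) auto
  have "n = 0 \<or> n = 1 \<or> n = 2 \<or> n = 3 \<or> n = 4 \<or> (\<exists>m\<ge>2. n = 2 * m + 1) \<or> (\<exists>m\<ge>3. n = 2 * m)"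
    by presburger
  then show ?case unfolding x by blast
qed (auto, presburger+)
termination by (relation "Wellfounded.measure (\<lambda>(a, d, n). n)") auto


section \<open>Values of functions at geometric points\<close>

definition edwards_curve :: "'f::field \<Rightarrow> 'f \<Rightarrow> ('f \<times> 'f) set" where
  "edwards_curve a d = {(x, y). a * x^2 + y^2 = 1 + d * x^2 * y^2}"

definition eval_ac :: "'k::field poly poly \<Rightarrow> 'k alg_closure \<times> 'k alg_closure \<Rightarrow> 'k alg_closure" where
  "eval_ac p P = poly (map_poly (\<lambda>c. poly (map_poly to_ac c) (fst P)) p) (snd P)"

text \<open>The value at a point \<open>P\<close> of the curve of an element that is regular at \<open>P\<close>, i.e.\ that can be
  written as $p/q$ with $q(P) \neq 0$. The result is unspecified if the element is not regular
  at \<open>P\<close>.\<close>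

definition ff_value ::
    "'k::field \<Rightarrow> 'k \<Rightarrow> ('k poly poly set \<times> 'k poly poly set) set \<Rightarrow>
     'k alg_closure \<times> 'k alg_closure \<Rightarrow> 'k alg_closure" where
  "ff_value a d \<phi> P =
     (THE z. \<exists>p q. \<phi> = ff_quot a d p q \<and> eval_ac q P \<noteq> 0 \<and> z = eval_ac p P / eval_ac q P)"


section \<open>The Weierstrass model and torsion points\<close>

datatype 'f wpoint = Infinity | Affine 'f 'f

text \<open>Chord and tangent addition on $v^2 = u^3 + Au + B$.\<close>

fun w_add :: "'f::field \<Rightarrow> 'f wpoint \<Rightarrow> 'f wpoint \<Rightarrow> 'f wpoint" where
  "w_add A Infinity Q = Q"
| "w_add A (Affine u v) Infinity = Affine u v"
| "w_add A (Affine u1 v1) (Affine u2 v2) =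
     (if u1 = u2 \<and> v1 = - v2 then Infinity
      else let l = (if u1 = u2 then (3 * u1^2 + A) / (2 * v1) else (v2 - v1) / (u2 - u1));
               u3 = l^2 - u1 - u2
           in Affine u3 (l * (u1 - u3) - v1))"

primrec w_mult :: "'f::field \<Rightarrow> nat \<Rightarrow> 'f wpoint \<Rightarrow> 'f wpoint" where
  "w_mult A 0 Q = Infinity"
| "w_mult A (Suc n) Q = w_add A Q (w_mult A n Q)"

definition edwards_wA :: "'f::field \<Rightarrow> 'f \<Rightarrow> 'f" where
  "edwards_wA a d = - ((a^2 + 14 * a * d + d^2) / 48)"

definition edwards_wB :: "'f::field \<Rightarrow> 'f \<Rightarrow> 'f" where
  "edwards_wB a d = - ((a^3 - 33 * a^2 * d - 33 * a * d^2 + d^3) / 864)"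

definition weierstrass_curve :: "'f::field \<Rightarrow> 'f \<Rightarrow> 'f wpoint set" where
  "weierstrass_curve A B = {Infinity} \<union> {Affine u v | u v. v^2 = u^3 + A * u + B}"

definition edwards_to_w :: "'f::field \<Rightarrow> 'f \<Rightarrow> 'f \<times> 'f \<Rightarrow> 'f wpoint" where
  "edwards_to_w a d P = (case P of (x, y) \<Rightarrow>
     if x * (1 - y) \<noteq> 0 then
       Affine (((5 * a - d) + (a - 5 * d) * y) / (12 * (1 - y)))
              (((a - d) * (1 + y)) / (4 * x * (1 - y)))
     else if (x, y) = (0, 1) then Infinity
     else Affine ((a + d) / 6) 0)"

lemma Affine_in_weierstrass_curve:
  "Affine u v \<in> weierstrass_curve A B \<longleftrightarrow> v^2 = u^3 + A * u + B"
  by (simp add: weierstrass_curve_def)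

lemma inverse_numerals_of_twelve:
  fixes i :: "'f::field"
  assumes i: "12 * i = 1"
  shows "inverse (4::'f) = 3 * i" "inverse (6::'f) = 2 * i"
    "inverse (48::'f) = 3 * i^2" "inverse (864::'f) = 2 * i^3"
proof -
  have inv: "inverse c = e" if "c * e = 1" for c e :: 'f
    using that by (rule inverse_unique)
  show "inverse (4::'f) = 3 * i" by (rule inv) (use i in simp)
  show "inverse (6::'f) = 2 * i" by (rule inv) (use i in simp)
  have "(48::'f) * (3 * i^2) = (12 * i)^2" by (simp add: power_mult_distrib)
  then show "inverse (48::'f) = 3 * i^2" unfolding i by (intro inv) simp
  have "(864::'f) * (2 * i^3) = (12 * i)^3" by (simp add: power_mult_distrib)
  then show "inverse (864::'f) = 2 * i^3" unfolding i by (intro inv) simp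
qed

lemma edwards_to_w_in_weierstrass_curve:
  fixes a d :: "'f::field"
  assumes "(2::'f) \<noteq> 0" "(3::'f) \<noteq> 0" and P: "P \<in> edwards_curve a d"
  shows "edwards_to_w a d P \<in> weierstrass_curve (edwards_wA a d) (edwards_wB a d)"
proof -
  obtain x y where xy: "P = (x, y)" by (cases P)
  have E: "a * x^2 + y^2 = 1 + d * x^2 * y^2"
    using P by (simp add: xy edwards_curve_def)
  have "(2::'f)^2 * 3 \<noteq> 0"
    using assms by (intro no_zero_divisors power_not_zero)
  then have num: "(12::'f) \<noteq> 0"
    by simp
  show ?thesis
  proof (cases "x * (1 - y) = 0")
    case False
    define r s where "r = inverse x" and "s = inverse (1 - y)"
    define i where "i = inverse (12::'f)"
    have r: "x * r = 1" and s: "(1 - y) * s = 1" and i: "12 * i = 1"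
      using False num by (auto simp: r_def s_def i_def)
    note four = inverse_numerals_of_twelve[OF i]
    have u: "((5 * a - d) + (a - 5 * d) * y) / (12 * (1 - y)) = ((5 * a - d) + (a - 5 * d) * y) * i * s"
      unfolding i_def s_def divide_inverse inverse_mult_distrib by (simp only: mult_ac)
    have v: "((a - d) * (1 + y)) / (4 * x * (1 - y)) = 3 * i * ((a - d) * (1 + y)) * r * s"
      unfolding r_def s_def divide_inverse inverse_mult_distrib four by (simp only: mult_ac)
    have A: "edwards_wA a d = - ((a^2 + 14 * a * d + d^2) * (3 * i^2))"
      unfolding edwards_wA_def divide_inverse four ..
    have B: "edwards_wB a d = - ((a^3 - 33 * a^2 * d - 33 * a * d^2 + d^3) * (2 * i^3))"
      unfolding edwards_wB_def divide_inverse four ..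
    define M where "M = 6 * (a - d) * s - (a - 5 * d)"
    have ys: "y * s = s - 1"
      using s by (simp add: algebra_simps)
    have "((5 * a - d) + (a - 5 * d) * y) * s = (5 * a - d) * s + (a - 5 * d) * (y * s)"
      by (simp add: algebra_simps)
    also have "\<dots> = M"
      unfolding ys M_def by (simp add: algebra_simps)
    finally have M: "((5 * a - d) + (a - 5 * d) * y) * i * s = M * i"
      by (metis mult.assoc mult.commute)
    have xx: "(a - d * y^2) * x^2 = (1 - y) * (1 + y)"
      using E by (simp add: algebra_simps power2_eq_square)
    have "(a - d * y^2) * (x * r)^2 * s = ((a - d * y^2) * x^2) * r^2 * s"
      by (simp only: power_mult_distrib mult_ac)
    also have "\<dots> = ((1 - y) * s) * ((1 + y) * r^2)"
      unfolding xx by (simp only: mult_ac)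
    finally have rr: "(1 + y) * r^2 = (a - d * y^2) * s"
      unfolding r s by simp
    have "(3 * i * ((a - d) * (1 + y)) * r * s)^2
        = (3 * i * (a - d))^2 * ((1 + y) * s) * s * ((1 + y) * r^2)"
      by (simp only: power2_eq_square mult_ac)
    also have "\<dots> = (3 * i * (a - d))^2 * ((1 + y) * s) * ((a - d * y^2) * s^2)"
      unfolding rr by (simp only: power2_eq_square mult_ac)
    also have "(1 + y) * s = 2 * s - 1"
      using ys by (simp add: distrib_right)
    also have "(a - d * y^2) * s^2 = a * s^2 - d * (y * s)^2"
      by (simp add: left_diff_distrib power_mult_distrib)
    also have "(3 * i * (a - d))^2 * (2 * s - 1) * (a * s^2 - d * (y * s)^2)
        = (12 * i) * (9 * i^2 * (a - d)^2 * (2 * s - 1) * (a * s^2 - d * (s - 1)^2))"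
      unfolding ys i by (simp add: power_mult_distrib)
    also have "\<dots> = (M * i)^3 - ((a^2 + 14 * a * d + d^2) * (3 * i^2)) * (M * i)
        - (a^3 - 33 * a^2 * d - 33 * a * d^2 + d^3) * (2 * i^3)"
      unfolding M_def by (simp add: algebra_simps power2_eq_square power3_eq_cube)
    finally have "(3 * i * ((a - d) * (1 + y)) * r * s)^2
        = (M * i)^3 + edwards_wA a d * (M * i) + edwards_wB a d"
      unfolding A B by simp
    moreover have "edwards_to_w a d P = Affine (M * i) (3 * i * ((a - d) * (1 + y)) * r * s)"
      using False unfolding xy edwards_to_w_def prod.case u v M by (simp only: simp_thms if_True)
    ultimately show ?thesis
      by (simp add: weierstrass_curve_def)
  next
    case True
    define i where "i = inverse (12::'f)"
    have i: "12 * i = 1"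
      using num by (simp add: i_def)
    note four = inverse_numerals_of_twelve[OF i]
    have "0 = ((a + d) * (2 * i))^3
        - ((a^2 + 14 * a * d + d^2) * (3 * i^2)) * ((a + d) * (2 * i))
        - (a^3 - 33 * a^2 * d - 33 * a * d^2 + d^3) * (2 * i^3)"
      by (simp add: algebra_simps power2_eq_square power3_eq_cube)
    then have "0 = ((a + d) / 6)^3 + edwards_wA a d * ((a + d) / 6) + edwards_wB a d"
      unfolding edwards_wA_def edwards_wB_def divide_inverse four by simp
    then have "Affine ((a + d) / 6) 0 \<in> weierstrass_curve (edwards_wA a d) (edwards_wB a d)"
      unfolding Affine_in_weierstrass_curve by simp
    moreover have "edwards_to_w a d P \<in> {Infinity, Affine ((a + d) / 6) 0}"
      using True by (auto simp: xy edwards_to_w_def)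
    ultimately show ?thesis
      using weierstrass_curve_def by auto
  qed
qed

text \<open>The denominators of the addition formula on the Edwards curve can vanish over an
  algebraically closed field, so multiples of points are taken on the Weierstrass model.\<close>

definition edwards_torsion :: "'f::field \<Rightarrow> 'f \<Rightarrow> nat \<Rightarrow> 'f \<times> 'f \<Rightarrow> bool" where
  "edwards_torsion a d n P \<longleftrightarrow>
     P \<in> edwards_curve a d \<and> w_mult (edwards_wA a d) n (edwards_to_w a d P) = Infinity"

end

theory Submission
  imports Defs
begin

text \<open>
  Let \<open>P = (x, y)\<close> be a point of the curve other than \<open>(0, 1)\<close> and \<open>(0, -1)\<close>. Then \<open>x\<close>, \<open>1 - y\<close> and
  \<open>1 + y\<close> do not vanish, so all $\psi_n$ are regular at \<open>P\<close> and $\psi_2(P) \neq 0$. Evaluation at \<open>P\<close>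
  therefore carries the recursion in the function field over to the values (\<open>has_value_psi\<close>), and
  these form a sequence $s_n$ of numbers with $s_2 = 2v \neq 0$, where \<open>Q = (u, v)\<close> is the image
  of \<open>P\<close> on the Weierstrass curve. It remains to see that $s_n = 0$ exactly if $[n]Q$ is the
  point at infinity.

  The multiples $[n]Q$ arise by adding \<open>Q\<close> again and again, whereas the recursion for $s_n$ doubles
  the index. Two relations between five consecutive terms (\<open>somos_at\<close>) connect the two:
  \[ s_{n+2} s_{n-2} = s_2^2 s_{n+1} s_{n-1} - s_3 s_n^2, \qquad
     s_{n+2} s_{n-1}^2 + s_{n-2} s_{n+1}^2 = (\gamma s_{n-1} s_{n+1} - s_2^2 s_n^2) s_n, \]
  with $\gamma = 6u^2 + 2A$. Given these, the classical formula
  $u([n]Q) = u - s_{n-1}s_{n+1}/s_n^2$ and its companion for the second coordinate follow by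
  induction on \<open>n\<close>, since the chord and tangent formulas for adding \<open>Q\<close> involve only such a window
  of the sequence (\<open>w_add_somos_point\<close>). Zeros cause no harm because two consecutive terms are
  never both zero.

  To obtain the two relations from the doubling recursion, put $e_n = s_{n-1}s_{n+1}/s_n^2$. Both
  relations together say that $e_{n-1}$ and $e_{n+1}$ are the two roots of
  $X^2 e_n^2 + s_2^2 (X + e_n) - s_3 = \gamma X e_n$, a symmetric biquadratic equation. The doubling
  recursion expresses $e_{2m}$ and $e_{2m+1}$ by $e_{m-1}, \dots, e_{m+2}$, and a single identity of
  rational functions (\<open>biquadratic_doubling\<close>) shows that the new pair satisfies the same equation.
  This needs $s_n \neq 0$. So the relations are proved first for the universal sequence
  over $\mathbb{Z}[b, c, \gamma]$, none of whose terms of positive index vanishes because it specializes to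
  $s_n = n$, and are then carried to every ring by evaluation (\<open>eds_somos\<close>).

  Computing in the function field requires that the coordinate ring is a domain, that is, that the
  defining polynomial is prime. It is quadratic in \<open>y\<close> over \<open>k[x]\<close>, with
  $y^2 = (1 - a x^2)/(1 - d x^2)$, and this quotient is not a square in \<open>k(x)\<close>.
\<close>

section \<open>Ring homomorphisms between types and polynomial evaluation\<close>

text \<open>Evaluation of polynomials in several variables is used twice: to specialize identities from
  $\mathbb{Z}[b, c, \gamma]$, and to take values at a point of the curve. Both are iterations of the
  map \<open>p \<mapsto> poly (map_poly h p) x\<close> for a homomorphism \<open>h\<close> of the coefficients.\<close>

locale type_ring_hom =
  fixes h :: "'a::comm_ring_1 \<Rightarrow> 'b::comm_ring_1"
  assumes hom_one: "h 1 = 1"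
    and hom_add: "h (x + y) = h x + h y"
    and hom_mult: "h (x * y) = h x * h y"
begin

lemma hom_zero: "h 0 = 0"
  using hom_add[of 0 0] by simp

lemma hom_minus: "h (- x) = - h x"
  using hom_add[of x "- x"] by (simp add: hom_zero eq_neg_iff_add_eq_0 add.commute)

lemma hom_diff: "h (x - y) = h x - h y"
  using hom_add[of x "- y"] by (simp add: hom_minus)

lemma hom_power: "h (x ^ n) = h x ^ n"
  by (induction n) (simp_all add: hom_one hom_mult)

lemmas hom_simps =hom_zero hom_one hom_add hom_mult hom_minus hom_diff hom_power

lemma poly_map_pCons:
  "poly (map_poly h (pCons a p)) x = h a + x * poly (map_poly h p) x"
  by (simp add: map_poly_pCons hom_zero)

lemma hom_sum: "h (sum f A) = (\<Sum>x\<in>A. h (f x))"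
  by (induction A rule: infinite_finite_induct) (simp_all add: hom_zero hom_add)

lemma hom_of_nat: "h (of_nat n) = of_nat n"
  by (induction n) (simp_all add: hom_zero hom_one hom_add)

lemma hom_numeral: "h (numeral n) = numeral n"
  using hom_of_nat[of "numeral n"] by simp

lemma map_poly_hom: "type_ring_hom (map_poly h)"
proof
  show "map_poly h 1 = 1"
    by (simp add: hom_one)
  show "map_poly h (p + q) = map_poly h p + map_poly h q" for p q
    by (rule poly_eqI) (simp add: coeff_map_poly hom_zero hom_add)
  show "map_poly h (p * q) = map_poly h p * map_poly h q" for p q
    by (rule poly_eqI) (simp add: coeff_map_poly coeff_mult hom_zero hom_sum hom_mult)
qed

lemma poly_map_hom: "type_ring_hom (\<lambda>p. poly (map_poly h p) x)"
proof -
  interpret m: type_ring_hom "map_poly h"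
    by (rule map_poly_hom)
  show ?thesis
    by standard (simp_all add: m.hom_simps)
qed

end

lemma of_int_type_ring_hom: "type_ring_hom of_int"
  by standard simp_all

lemma to_fract_type_ring_hom: "type_ring_hom to_fract"
  by standard simp_all

section \<open>Elliptic divisibility sequences and their five-term relations\<close>

text \<open>The recursion for even indices divides by $s_2$. Writing $s_n = b \hat s_n$ for even \<open>n\<close> and
  $s_n = \hat s_n$ for odd \<open>n\<close>, with $b = s_2$, removes the division: \<open>pre_eds\<close> is the sequence
  $\hat s_n$, given by $b$, $c = s_3$ and $d = s_4/s_2$. Hence it exists over every commutative ring
  and commutes with homomorphisms. The powers $b^4$ account for the factors \<open>b\<close> in a product of
  four terms of even index.\<close>

fun pre_eds :: "'a::comm_ring_1 \<Rightarrow> 'a \<Rightarrow> 'a \<Rightarrow> nat \<Rightarrow> 'a" where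
  "pre_eds b c d n =
     (if n = 0 then 0 else if n \<le> 2 then 1 else if n = 3 then c else if n = 4 then d
      else let m = n div 2 in
        if even n then
          pre_eds b c d m * (pre_eds b c d (m + 2) * pre_eds b c d (m - 1) ^ 2
            - pre_eds b c d (m - 2) * pre_eds b c d (m + 1) ^ 2)
        else
          (if even m then b ^ 4 else 1) * pre_eds b c d (m + 2) * pre_eds b c d m ^ 3
            - (if even m then 1 else b ^ 4) * pre_eds b c d (m - 1) * pre_eds b c d (m + 1) ^ 3)"

declare pre_eds.simps [simp del]

definition eds :: "'a::comm_ring_1 \<Rightarrow> 'a \<Rightarrow> 'a \<Rightarrow> nat \<Rightarrow> 'a" where
  "eds b c d n = (if even n then b else 1) * pre_eds b c d n"

lemma eds_initial:
  "eds b c d 0 = 0" "eds b c d 1 = 1" "eds b c d 2 = b" "eds b c d 3 = c" "eds b c d 4 = b * d"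
  by (simp_all add: eds_def pre_eds.simps)

lemma eds_odd:
  assumes "m \<ge> 2"
  shows "eds b c d (2 * m + 1) =
    eds b c d (m + 2) * eds b c d m ^ 3 - eds b c d (m - 1) * eds b c d (m + 1) ^ 3"
proof -
  have "pre_eds b c d (2 * m + 1) =
     (if even m then b ^ 4 else 1) * pre_eds b c d (m + 2) * pre_eds b c d m ^ 3
            - (if even m then 1 else b ^ 4) * pre_eds b c d (m - 1) * pre_eds b c d (m + 1) ^ 3"
    using assms by (subst pre_eds.simps) (simp add: Let_def)
  moreover have "even (m - 1) \<longleftrightarrow> odd m"
    using assms by simp
  ultimately show ?thesis
    by (simp add: eds_def power_mult_distrib power_numeral_reduce)
qed

lemma eds_even:
  assumes "m \<ge> 3"
  shows "b * eds b c d (2 * m) = eds b c d m *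
    (eds b c d (m + 2) * eds b c d (m - 1) ^ 2 - eds b c d (m - 2) * eds b c d (m + 1) ^ 2)"
proof -
  have "pre_eds b c d (2 * m) =
          pre_eds b c d m * (pre_eds b c d (m + 2) * pre_eds b c d (m - 1) ^ 2
            - pre_eds b c d (m - 2) * pre_eds b c d (m + 1) ^ 2)"
    using assms by (subst pre_eds.simps) (simp add: Let_def)
  moreover have "even (m - 1) \<longleftrightarrow> odd m" "even (m - 2) \<longleftrightarrow> even m"
    using assms by simp_all
  ultimately show ?thesis
    by (cases "even m") (simp_all add: eds_def power_mult_distrib power2_eq_square right_diff_distrib mult_ac)
qed

lemma (in type_ring_hom) hom_eds: "h (eds b c d n) = eds (h b) (h c) (h d) n"
proof -
  have "h (pre_eds b c d n) = pre_eds (h b) (h c) (h d) n"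
  proof (induction n rule: less_induct)
    case (less n)
    have "n < 5 \<or> n \<ge> 5" by linarith
    then show ?case
    proof
      assume "n < 5"
      then show ?thesis
        by (subst (1 2) pre_eds.simps) (simp add: hom_zero hom_one)
    next
      assume n: "n \<ge> 5"
      have "h (pre_eds b c d j) = pre_eds (h b) (h c) (h d) j"
        if "j \<in> {n div 2 - 2, n div 2 - 1, n div 2, n div 2 + 1, n div 2 + 2}" for j
        by (rule less.IH) (use n that in auto)
      then show ?thesis
        using n by (subst (1 2) pre_eds.simps) (simp add: Let_def hom_simps)
    qed
  qed
  then show ?thesis
    by (simp add: eds_def hom_simps)
qed

text \<open>These are the division polynomials of the cuspidal cubic $v^2 = u^3$ at \<open>(1, 1)\<close>, whose smooth
  points form the additive group. The lemma is a witness that no term of the universal sequence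
  with positive index is zero.\<close>

lemma eds_2_3_2: "eds (2::int) 3 2 n = int n"
proof (induction n rule: less_induct)
  case (less n)
  have "n = 0 \<or> n = 1 \<or> n = 2 \<or> n = 3 \<or> n = 4 \<or> (\<exists>m\<ge>2. n = 2 * m + 1) \<or> (\<exists>m\<ge>3. n = 2 * m)"
    by presburger
  then consider "n \<in> {0, 1, 2, 3, 4}" | m where "m \<ge> 2" "n = 2 * m + 1" | m where "m \<ge> 3" "n = 2 * m"
    by blast
  then show ?case
  proof cases
    case 1
    then show ?thesis using eds_initial[of "2::int" 3 2] by auto
  next
    case 2
    obtain k where k: "m = k + 2" using \<open>m \<ge> 2\<close> by (metis le_Suc_ex add.commute)
    have "eds (2::int) 3 2 (m + 2) = int (m + 2)" "eds (2::int) 3 2 m = int m"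
      "eds (2::int) 3 2 (m - 1) = int (m - 1)" "eds (2::int) 3 2 (m + 1) = int (m + 1)"
      by (rule less.IH, use 2 in simp)+
    then show ?thesis
      unfolding \<open>n = _\<close> eds_odd[OF \<open>m \<ge> 2\<close>]
      by (simp add: k algebra_simps power3_eq_cube)
  next
    case 3
    obtain k where k: "m = k + 3" using \<open>m \<ge> 3\<close> by (metis le_Suc_ex add.commute)
    have "eds (2::int) 3 2 (m + 2) = int (m + 2)" "eds (2::int) 3 2 m = int m"
      "eds (2::int) 3 2 (m - 1) = int (m - 1)" "eds (2::int) 3 2 (m + 1) = int (m + 1)"
      "eds (2::int) 3 2 (m - 2) = int (m - 2)"
      by (rule less.IH, use 3 in simp)+
    then have "2 * eds (2::int) 3 2 n = 2 * int n"
      unfolding \<open>n = _\<close> eds_even[OF \<open>m \<ge> 3\<close>]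
      by (simp add: k algebra_simps power2_eq_square)
    then show ?thesis by simp
  qed
qed

text \<open>For a point \<open>Q\<close> of a Weierstrass curve, this is the relation between \<open>x = u(Q) - u(R)\<close> and
  \<open>y = u(Q) - u(R + Q)\<close> for varying \<open>R\<close>. As a quadratic equation in \<open>y\<close> it has a second root, which
  belongs to \<open>R - Q\<close>.\<close>

definition biquadratic :: "'a::comm_ring_1 \<Rightarrow> 'a \<Rightarrow> 'a \<Rightarrow> 'a \<Rightarrow> 'a \<Rightarrow> bool" where
  "biquadratic \<alpha> \<beta> \<gamma> x y \<longleftrightarrow> x^2 * y^2 + \<alpha> * (x + y) + \<beta> = \<gamma> * x * y"

lemma biquadratic_sym: "biquadratic \<alpha> \<beta> \<gamma> x y \<longleftrightarrow> biquadratic \<alpha> \<beta> \<gamma> y x"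
  by (simp add: biquadratic_def algebra_simps)

text \<open>Vieta's formulas for the biquadratic equation, read as a quadratic one in its second argument.\<close>

lemma biquadratic_roots:
  fixes z :: "'a::field"
  assumes p: "biquadratic \<alpha> \<beta> \<gamma> z p" and q: "biquadratic \<alpha> \<beta> \<gamma> z q" and "p \<noteq> q"
  shows "z^2 * (p + q) = \<gamma> * z - \<alpha>" "z^2 * (p * q) = \<alpha> * z + \<beta>"
proof -
  have "(p - q) * (z^2 * (p + q) - (\<gamma> * z - \<alpha>)) =
      (z^2 * p^2 + \<alpha> * (z + p) + \<beta> - \<gamma> * z * p) - (z^2 * q^2 + \<alpha> * (z + q) + \<beta> - \<gamma> * z * q)"
    by (simp add: algebra_simps power2_eq_square)
  also have "\<dots> = 0"
    using p q by (simp add: biquadratic_def)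
  finally show sum: "z^2 * (p + q) = \<gamma> * z - \<alpha>"
    using \<open>p \<noteq> q\<close> by simp
  have "z^2 * (p * q) = p * (z^2 * (p + q)) - z^2 * p^2"
    by (simp add: algebra_simps power2_eq_square)
  also have "\<dots> = \<alpha> * z + \<beta>"
    using p unfolding sum biquadratic_def by (simp add: algebra_simps)
  finally show "z^2 * (p * q) = \<alpha> * z + \<beta>" .
qed

lemma biquadratic_other_root:
  fixes z :: "'a::field"
  assumes q: "biquadratic \<alpha> \<beta> \<gamma> z q" and prod: "z^2 * (q * p) = \<alpha> * z + \<beta>" and "q \<noteq> 0"
  shows "biquadratic \<alpha> \<beta> \<gamma> z p"
proof -
  have "q * (z^2 * q + z^2 * p + \<alpha> - \<gamma> * z) =
      z^2 * q^2 + \<alpha> * (z + q) + \<beta> - \<gamma> * z * q + (z^2 * (q * p) - (\<alpha> * z + \<beta>))"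
    by (simp add: algebra_simps power2_eq_square)
  also have "\<dots> = 0"
    unfolding prod using q by (simp add: biquadratic_def)
  finally have "z^2 * q + z^2 * p + \<alpha> - \<gamma> * z = 0"
    using \<open>q \<noteq> 0\<close> by simp
  then have "p * (z^2 * q + z^2 * p + \<alpha> - \<gamma> * z) = 0"
    by simp
  then have "z^2 * (q * p) + z^2 * p^2 + \<alpha> * p - \<gamma> * z * p = 0"
    by (simp add: algebra_simps power2_eq_square)
  then show ?thesis
    unfolding prod biquadratic_def by (simp add: algebra_simps)
qed

text \<open>Let \<open>q, z, w, r\<close> be four consecutive ratios $e_{m-1}, \dots, e_{m+2}$. The two fractions are
  $e_{2m}$ and $e_{2m+1}$ as the doubling recursion gives them. Since \<open>q\<close>, \<open>r\<close> and \<open>\<gamma>\<close> are rational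
  functions of \<open>z\<close>, \<open>w\<close>, \<open>\<alpha>\<close> and \<open>\<beta>\<close>, the claim is an identity of rational functions in four free
  variables.\<close>

lemma biquadratic_doubling:
  fixes z :: "'a::field"
  assumes zw: "biquadratic \<alpha> \<beta> \<gamma> z w"
    and q: "z^2 * (w * q) = \<alpha> * z + \<beta>" and r: "w^2 * (r * z) = \<alpha> * w + \<beta>"
    and nz: "\<alpha> \<noteq> 0" "z \<noteq> 0" "w \<noteq> 0" "w \<noteq> z" "w \<noteq> q"
  shows "biquadratic \<alpha> \<beta> \<gamma> (\<alpha> * (w - z) * (z - q) / (z^2 * (w - q)^2))
           (z^2 * w^2 * (w - q) * (r - z) / (\<alpha> * (w - z)^2))"
proof -
  define K where "K = z^2 * w^2 - \<alpha> * z - \<beta>"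
  define L where "L = z^2 * w^2 - \<alpha> * w - \<beta>"
  define M where "M = z^3 * w - \<alpha> * z - \<beta>"
  define D where "D = w - z"
  have wq: "z^2 * w * (w - q) = K"
    unfolding K_def using q by (simp add: algebra_simps power2_eq_square)
  have rz: "w^2 * z * (r - z) = - L"
    unfolding L_def using r by (simp add: algebra_simps power2_eq_square)
  have zq: "z^2 * w * (z - q) = M"
    unfolding M_def using q by (simp add: algebra_simps power2_eq_square power3_eq_cube)
  have K: "K \<noteq> 0" unfolding wq[symmetric] using nz by simp
  have D: "D \<noteq> 0" using nz by (simp add: D_def)
  have gen: "\<alpha> * D * F / (z^2 * E^2) = \<alpha> * w * D * (z^2 * w * F) / (z^2 * w * E)^2"
    if "E \<noteq> 0" for E F
    using nz that by (simp add: field_simps power2_eq_square)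
  have X: "\<alpha> * (w - z) * (z - q) / (z^2 * (w - q)^2) = \<alpha> * w * D * M / K^2"
    unfolding wq[symmetric] zq[symmetric] D_def[symmetric]
    by (rule gen) (use nz in simp)
  have gen: "z^2 * w^2 * E * F / (\<alpha> * D^2) = (z^2 * w * E) * (w^2 * z * F) / (\<alpha> * z * w * D^2)" for E F
    using nz D by (simp add: field_simps power2_eq_square)
  have Y: "z^2 * w^2 * (w - q) * (r - z) / (\<alpha> * (w - z)^2) = K * (- L) / (\<alpha> * z * w * D^2)"
    unfolding wq[symmetric] rz[symmetric] D_def[symmetric] by (rule gen)
  have g: "\<gamma> = (z^2 * w^2 + \<alpha> * (z + w) + \<beta>) / (z * w)"
    using zw nz by (simp add: biquadratic_def field_simps)
  \<comment> \<open>The claim after clearing denominators, with \<open>\<gamma> z w\<close> written out.\<close>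
  have key: "w * M^2 * L^2 + \<alpha>^2 * w^2 * z^2 * D^3 * M - K^3 * L * z + \<beta> * K^2 * z^2 * D^2 * w
     + (z^2 * w^2 + \<alpha> * (z + w) + \<beta>) * M * L * K * D = 0"
    unfolding K_def L_def M_def D_def by (simp add: algebra_simps power2_eq_square power3_eq_cube)
  \<comment> \<open>Here \<open>K\<close>, \<open>L\<close>, \<open>M\<close> and \<open>D\<close> stay opaque, so that clearing denominators does not expand them.\<close>
  have clear: "biquadratic \<alpha> \<beta> (G / (z * w)) (\<alpha> * w * D * M / K^2) (K * (- L) / (\<alpha> * z * w * D^2))"
    if "w * M^2 * L^2 + \<alpha>^2 * w^2 * z^2 * D^3 * M - K^3 * L * z + \<beta> * K^2 * z^2 * D^2 * w
     + G * M * L * K * D = 0" for G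
  proof -
    have XY: "(\<alpha> * w * D * M / K^2) * (K * (- L) / (\<alpha> * z * w * D^2)) = - (M * L) / (K * z * D)"
      using nz K D by (simp add: field_simps power2_eq_square)
    have "(- (M * L) / (K * z * D))^2 + \<alpha> * (\<alpha> * w * D * M / K^2 + K * (- L) / (\<alpha> * z * w * D^2)) + \<beta>
        - (G / (z * w)) * (- (M * L) / (K * z * D)) =
      (w * M^2 * L^2 + \<alpha>^2 * w^2 * z^2 * D^3 * M - K^3 * L * z + \<beta> * K^2 * z^2 * D^2 * w
     + G * M * L * K * D) / (K^2 * z^2 * D^2 * w)"
      using nz K D by (simp add: field_simps power2_eq_square power3_eq_cube)
    then have "(- (M * L) / (K * z * D))^2 + \<alpha> * (\<alpha> * w * D * M / K^2 + K * (- L) / (\<alpha> * z * w * D^2)) + \<beta>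
        - (G / (z * w)) * (- (M * L) / (K * z * D)) = 0"
      unfolding that by simp
    then show ?thesis
      unfolding biquadratic_def XY[symmetric] by (simp only: power_mult_distrib right_minus_eq mult.assoc)
  qed
  show ?thesis
    unfolding X Y g by (rule clear[OF key])
qed


text \<open>The ratios $e_n$ satisfy the biquadratic equation in consecutive pairs, by strong induction: the
  pair at \<open>2m\<close> comes from \<open>biquadratic_doubling\<close>, and the pair at \<open>2m + 1\<close> from the same lemma
  read backwards, because the equation is symmetric. The neighbours $e_{n-1}$ and $e_{n+1}$ are
  different roots since their difference is a multiple of $s_{2n}$, so Vieta's formulas for $e_n$
  hold, and clearing denominators turns them into the two relations.\<close>

lemma somos_of_nonzero:
  fixes s :: "nat \<Rightarrow> 'a::field"
  assumes init: "s 0 = 0" "s 1 = 1"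
    and odd: "\<And>m. m \<ge> 2 \<Longrightarrow> s (2 * m + 1) = s (m + 2) * s m ^ 3 - s (m - 1) * s (m + 1) ^ 3"
    and even: "\<And>m. m \<ge> 3 \<Longrightarrow>
      s 2 * s (2 * m) = s m * (s (m + 2) * s (m - 1) ^ 2 - s (m - 2) * s (m + 1) ^ 2)"
    and \<gamma>: "\<gamma> * s 3 * s 2 = s 4 + s 2 ^ 5"
    and nz: "\<And>n. n \<ge> 1 \<Longrightarrow> s n \<noteq> 0"
  shows "s (k + 4) * s k = s 2 ^ 2 * (s (k + 3) * s (k + 1)) - s 3 * s (k + 2) ^ 2" (is ?S4)
    and "s (k + 4) * s (k + 1) ^ 2 + s k * s (k + 3) ^ 2 =
      (\<gamma> * s (k + 1) * s (k + 3) - s 2 ^ 2 * s (k + 2) ^ 2) * s (k + 2)" (is ?sum)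
proof -
  define \<alpha> \<beta> where "\<alpha> = s 2 ^ 2" and "\<beta> = - s 3"
  define e where "e n = s (n - 1) * s (n + 1) / s n ^ 2" for n
  have snz: "s (Suc n) \<noteq> 0" "s (n + 1) \<noteq> 0" "s (n + 2) \<noteq> 0" "s (n + 3) \<noteq> 0" "s (n + 4) \<noteq> 0"
    "s (n + 5) \<noteq> 0" for n
    by (auto intro!: nz)
  have snz0: "s 2 \<noteq> 0" "s 3 \<noteq> 0" "s 4 \<noteq> 0"
    by (auto intro!: nz)
  have \<alpha>0: "\<alpha> \<noteq> 0" using snz0 by (simp add: \<alpha>_def)
  have e0: "e n \<noteq> 0" if "n \<ge> 2" for n
    unfolding e_def using that by (auto dest: nz[of n] simp: nz)
  have e_Suc: "e (n + 1) = s n * s (n + 2) / s (n + 1)^2" "e (n + 2) = s (n + 1) * s (n + 3) / s (n + 2)^2"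
     "e (n + 3) = s (n + 2) * s (n + 4) / s (n + 3)^2" "e (n + 4) = s (n + 3) * s (n + 5) / s (n + 4)^2" for n
    by (simp_all add: e_def numeral_eq_Suc)
  have odd': "s (2 * n + 5) = s (n + 4) * s (n + 2) ^ 3 - s (n + 1) * s (n + 3) ^ 3" for n
    using odd[of "n + 2"] by (simp add: numeral_eq_Suc)
  have odd'': "s (2 * n + 3) = s (n + 3) * s (n + 1) ^ 3 - s n * s (n + 2) ^ 3" for n
  proof (cases n)
    case 0 then show ?thesis using init by simp
  next
    case (Suc m) then show ?thesis using odd'[of m] by (simp add: numeral_eq_Suc)
  qed
  have even': "s 2 * s (2 * n + 4) = s (n + 2) * (s (n + 4) * s (n + 1) ^ 2 - s n * s (n + 3) ^ 2)" for n
  proof (cases n)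
    case 0 then show ?thesis using init by (simp add: numeral_2_eq_2)
  next
    case (Suc m) then show ?thesis using even[of "m + 3"] by (simp add: numeral_eq_Suc)
  qed
  have e_diff: "e (n + 3) - e (n + 1) = s 2 * s (2 * n + 4) / (s (n + 1)^2 * s (n + 3)^2)" for n
    unfolding e_Suc even' using snz0 snz[of n] by (simp add: field_simps)
  have e_neq: "e (n + 3) \<noteq> e (n + 1)" for n
  proof
    assume "e (n + 3) = e (n + 1)"
    then have "s 2 * s (2 * n + 4) / (s (n + 1)^2 * s (n + 3)^2) = 0"
      using e_diff[of n] by simp
    then show False using snz0 snz[of n] snz[of "2 * n"] by simp
  qed
  have e_neq': "e (n + 3) \<noteq> e (n + 2)" for n
  proof
    assume "e (n + 3) = e (n + 2)"
    then have "s (2 * n + 5) = 0"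
      unfolding e_Suc odd' using snz0 snz[of n] by (simp add: field_simps power2_eq_square power3_eq_cube)
    then show False using snz0 snz[of "2 * n"] by simp
  qed
  have e_even: "e (2 * n + 4) = \<alpha> * (e (n + 3) - e (n + 2)) * (e (n + 2) - e (n + 1)) /
      (e (n + 2)^2 * (e (n + 3) - e (n + 1))^2)" for n
  proof -
    have 1: "e (n + 3) - e (n + 2) = s (2 * n + 5) / (s (n + 2)^2 * s (n + 3)^2)"
      unfolding e_Suc odd' using snz0 snz[of n] by (simp add: field_simps power2_eq_square power3_eq_cube)
    have 2: "e (n + 2) - e (n + 1) = s (2 * n + 3) / (s (n + 1)^2 * s (n + 2)^2)"
      unfolding e_Suc odd'' using snz0 snz[of n] by (simp add: field_simps power2_eq_square power3_eq_cube)
    have 3: "e (2 * n + 4) = s (2 * n + 3) * s (2 * n + 5) / s (2 * n + 4) ^ 2"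
      using e_Suc(3)[of "2 * n + 1"] by (simp add: numeral_eq_Suc)
    show ?thesis
      unfolding 1 2 3 e_diff unfolding e_Suc \<alpha>_def using snz0 snz[of n] snz[of "2 * n"]
      by (simp add: field_simps power2_eq_square)
  qed
  have e_odd: "e (2 * n + 5) = e (n + 2)^2 * e (n + 3)^2 * (e (n + 3) - e (n + 1)) * (e (n + 4) - e (n + 2)) /
      (\<alpha> * (e (n + 3) - e (n + 2))^2)" for n
  proof -
    have 1: "e (n + 3) - e (n + 2) = s (2 * n + 5) / (s (n + 2)^2 * s (n + 3)^2)"
      unfolding e_Suc odd' using snz0 snz[of n] by (simp add: field_simps power2_eq_square power3_eq_cube)
    have 2: "e (n + 4) - e (n + 2) = s 2 * s (2 * n + 6) / (s (n + 2)^2 * s (n + 4)^2)"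
      using e_diff[of "n + 1"] by (simp add: numeral_eq_Suc)
    have 3: "e (2 * n + 5) = s (2 * n + 4) * s (2 * n + 6) / s (2 * n + 5) ^ 2"
      using e_Suc(3)[of "2 * n + 2"] by (simp add: numeral_eq_Suc)
    show ?thesis
      unfolding 1 2 3 e_diff unfolding e_Suc \<alpha>_def using snz0 snz[of n] snz[of "2 * n"]
      by (simp add: field_simps power2_eq_square)
  qed
  have bi: "biquadratic \<alpha> \<beta> \<gamma> (e (n + 1)) (e (n + 2))" for n
  proof (induction n rule: less_induct)
    case (less n)
    \<comment> \<open>Vieta's product formula at \<open>m + 2\<close> uses the equation for both pairs that contain \<open>e (m + 2)\<close>.\<close>
    have step: "e (m + 2)^2 * (e (m + 3) * e (m + 1)) = \<alpha> * e (m + 2) + \<beta>" if "m + 1 < n" for m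
      using biquadratic_roots(2)[of \<alpha> \<beta> \<gamma> "e (m + 2)" "e (m + 3)" "e (m + 1)"]
        less.IH[of m] less.IH[of "m + 1"] e_neq[of m] that
      by (simp add: biquadratic_sym numeral_eq_Suc)
    have "n = 0 \<or> n = 1 \<or> n = 2 \<or> (\<exists>m. n = 2 * m + 3) \<or> (\<exists>m. n = 2 * m + 4)"
      by presburger
    then consider "n = 0" | "n = 1" | "n = 2" | m where "n = 2 * m + 3" | m where "n = 2 * m + 4"
      by blast
    then show ?case
    proof cases
      case 1
      have "e 1 = 0" "e 2 = s 3 / s 2^2"
        using init by (simp_all add: e_def)
      then show ?thesis
        unfolding 1 add_0 using snz0 by (simp add: biquadratic_def \<alpha>_def \<beta>_def)
    next
      case 2
      \<comment> \<open>This pair determines the value of \<open>\<gamma>\<close>.\<close>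
      have start: "biquadratic (x^2) (- y) ((f + x^5) / (y * x)) (y / x^2) (x * f / y^2)"
        if "x \<noteq> 0" "y \<noteq> 0" for x y f :: 'a
        using that by (simp add: biquadratic_def field_simps eval_nat_numeral)
      have "\<gamma> = (s 4 + s 2 ^ 5) / (s 3 * s 2)"
        using \<gamma> snz0 by (simp add: field_simps)
      moreover have "e 2 = s 3 / s 2^2" "e 3 = s 2 * s 4 / s 3 ^2"
        using init by (simp_all add: e_def)
      moreover have "n + 1 = 2" "n + 2 = 3"
        using 2 by simp_all
      ultimately show ?thesis
        using start[OF snz0(1,2), of "s 4"] by (simp only: \<alpha>_def \<beta>_def)
    next
      case 3
      have "e 3^2 * (e 2 * e 4) = \<alpha> * e 3 + \<beta>"
      proof -
        have e: "e 2 = s 3 / s 2^2" "e 3 = s 2 * s 4 / s 3 ^2" "e 4 = s 3 * s 5 / s 4 ^2"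
          using init by (simp_all add: e_def)
        have 5: "s 5 = s 4 * s 2 ^ 3 - s 3 ^ 3"
          using odd'[of 0] init by (simp add: numeral_2_eq_2)
        show ?thesis
          unfolding e 5 \<alpha>_def \<beta>_def using snz0 by (simp add: field_simps power2_eq_square power3_eq_cube)
      qed
      moreover have "biquadratic \<alpha> \<beta> \<gamma> (e 3) (e 2)"
        using less.IH[of 1] 3 by (subst biquadratic_sym) (simp add: numeral_eq_Suc)
      ultimately have "biquadratic \<alpha> \<beta> \<gamma> (e 3) (e 4)"
        using e0[of 2] biquadratic_other_root by blast
      then show ?thesis using 3 by (simp add: numeral_eq_Suc)
    next
      case 4
      have "biquadratic \<alpha> \<beta> \<gamma> (e (2 * m + 4)) (e (2 * m + 5))"
        unfolding e_even e_odd
      proof (rule biquadratic_doubling)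
        show "biquadratic \<alpha> \<beta> \<gamma> (e (m + 2)) (e (m + 3))"
          using less.IH[of "m + 1"] 4 by (simp add: numeral_eq_Suc)
        show "e (m + 3)^2 * (e (m + 4) * e (m + 2)) = \<alpha> * e (m + 3) + \<beta>"
          using step[of "m + 1"] 4 by (simp add: numeral_eq_Suc)
      qed (use step[of m] 4 \<alpha>0 e0 e_neq[of m] e_neq'[of m] in simp_all)
      then show ?thesis by (simp add: 4 numeral_eq_Suc)
    next
      case 5
      define z w q r where "z = e (m + 2)" and "w = e (m + 3)" and "q = e (m + 1)" and "r = e (m + 4)"
      have "biquadratic \<alpha> \<beta> \<gamma> (\<alpha> * (z - w) * (w - r) / (w^2 * (z - r)^2))
           (w^2 * z^2 * (z - r) * (q - w) / (\<alpha> * (z - w)^2))"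
      proof (rule biquadratic_doubling)
        show "biquadratic \<alpha> \<beta> \<gamma> w z"
          using less.IH[of "m + 1"] 5 unfolding z_def w_def by (subst biquadratic_sym) (simp add: numeral_eq_Suc)
        show "w\<^sup>2 * (z * r) = \<alpha> * w + \<beta>"
          using step[of "m + 1"] 5 unfolding z_def w_def r_def by (simp add: numeral_eq_Suc mult_ac)
        show "z\<^sup>2 * (q * w) = \<alpha> * z + \<beta>"
          using step[of m] 5 unfolding z_def w_def q_def by (simp add: mult_ac)
        show "z \<noteq> r" using e_neq[of "m + 1"] unfolding z_def r_def by (simp add: numeral_eq_Suc)
      qed (use \<alpha>0 e0 e_neq'[of m] in \<open>simp_all add: z_def w_def\<close>)
      moreover have "e (2 * m + 6) = \<alpha> * (z - w) * (w - r) / (w^2 * (z - r)^2)"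
        using e_even[of "m + 1"] unfolding z_def w_def r_def
        by (simp add: numeral_eq_Suc power2_commute algebra_simps)
      moreover have "e (2 * m + 5) = w^2 * z^2 * (z - r) * (q - w) / (\<alpha> * (z - w)^2)"
        using e_odd[of "m"] unfolding z_def w_def r_def q_def
        by (simp add: power2_commute algebra_simps)
      ultimately show ?thesis
        unfolding 5 by (subst biquadratic_sym) (simp add: numeral_eq_Suc)
    qed
  qed
  have roots: "e (k + 2)^2 * (e (k + 3) + e (k + 1)) = \<gamma> * e (k + 2) - \<alpha>"
    "e (k + 2)^2 * (e (k + 3) * e (k + 1)) = \<alpha> * e (k + 2) + \<beta>"
    using biquadratic_roots[of \<alpha> \<beta> \<gamma> "e (k + 2)" "e (k + 3)" "e (k + 1)"] bi[of k] bi[of "k + 1"] e_neq[of k]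
    by (simp_all add: biquadratic_sym numeral_eq_Suc)
  have "e (k + 2)^2 * (e (k + 3) * e (k + 1)) = s (k + 4) * s k / s (k + 2)^2"
    unfolding e_Suc using snz[of k] by (simp add: field_simps power2_eq_square)
  then show ?S4
    using roots(2) snz[of k] unfolding e_Suc \<alpha>_def \<beta>_def by (simp add: field_simps)
  have "e (k + 2)^2 * (e (k + 3) + e (k + 1)) =
      (s (k + 4) * s (k + 1) ^ 2 + s k * s (k + 3) ^ 2) / s (k + 2)^3"
    unfolding e_Suc using snz[of k] by (simp add: field_simps power2_eq_square power3_eq_cube)
  moreover have "\<gamma> * e (k + 2) - \<alpha> =
      (\<gamma> * s (k + 1) * s (k + 3) - s 2 ^ 2 * s (k + 2) ^ 2) * s (k + 2) / s (k + 2)^3"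
    unfolding e_Suc \<alpha>_def using snz[of k] by (simp add: field_simps power2_eq_square power3_eq_cube)
  ultimately show ?sum
    using roots(1) snz(3)[of k] by simp
qed


text \<open>The five-term relations of the window that starts at \<open>k\<close>. The first is the Somos-4 recurrence. The
  second fixes its invariant \<open>g\<close>.\<close>

definition somos_at :: "'a::comm_ring_1 \<Rightarrow> 'a \<Rightarrow> 'a \<Rightarrow> (nat \<Rightarrow> 'a) \<Rightarrow> nat \<Rightarrow> bool" where
  "somos_at b c g t k \<longleftrightarrow>
     t (k + 4) * t k = b ^ 2 * (t (k + 3) * t (k + 1)) - c * t (k + 2) ^ 2 \<and>
     t (k + 4) * t (k + 1) ^ 2 + t k * t (k + 3) ^ 2 =
       (g * t (k + 1) * t (k + 3) - b ^ 2 * t (k + 2) ^ 2) * t (k + 2)"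

lemma (in type_ring_hom) hom_somos_at:
  assumes "somos_at b c g t k"
  shows "somos_at (h b) (h c) (h g) (\<lambda>n. h (t n)) k"
proof -
  have "h (t (k + 4) * t k) = h (b ^ 2 * (t (k + 3) * t (k + 1)) - c * t (k + 2) ^ 2)"
    "h (t (k + 4) * t (k + 1) ^ 2 + t k * t (k + 3) ^ 2) =
       h ((g * t (k + 1) * t (k + 3) - b ^ 2 * t (k + 2) ^ 2) * t (k + 2))"
    using assms by (simp_all only: somos_at_def)
  then show ?thesis
    by (simp only: somos_at_def hom_simps)
qed

text \<open>The ratios $e_n$ live in the field of fractions. The parameter $d = g c - b^4$ makes \<open>g\<close> the
  invariant, because $s_0 = 0$ and $s_1 = 1$ reduce the second relation for the first window to
  $s_4 = (g s_3 - s_2^4) s_2$.\<close>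

lemma eds_somos_idom:
  fixes b c g :: "'a::idom"
  assumes nz: "\<And>n. n \<ge> 1 \<Longrightarrow> eds b c (g * c - b ^ 4) n \<noteq> 0"
  shows "somos_at b c g (eds b c (g * c - b ^ 4)) k"
proof -
  interpret type_ring_hom "to_fract :: 'a \<Rightarrow> 'a fract"
    by (rule to_fract_type_ring_hom)
  define s where "s n = to_fract (eds b c (g * c - b ^ 4) n)" for n
  have s: "s n = eds (to_fract b) (to_fract c) (to_fract g * to_fract c - to_fract b ^ 4) n" for n
    unfolding s_def hom_eds hom_simps ..
  have init: "s 0 = 0" "s 1 = 1" "s 2 = to_fract b" "s 3 = to_fract c"
      "s 4 = to_fract b * (to_fract g * to_fract c - to_fract b ^ 4)"
    unfolding s eds_initial by (rule refl)+
  have odd: "s (2 * m + 1) = s (m + 2) * s m ^ 3 - s (m - 1) * s (m + 1) ^ 3" if "m \<ge> 2" for m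
    unfolding s by (rule eds_odd[OF that])
  have even: "s 2 * s (2 * m) = s m * (s (m + 2) * s (m - 1) ^ 2 - s (m - 2) * s (m + 1) ^ 2)"
    if "m \<ge> 3" for m
    unfolding s eds_initial(3) by (rule eds_even[OF that])
  have \<gamma>: "to_fract g * s 3 * s 2 = s 4 + s 2 ^ 5"
    unfolding init by (simp add: algebra_simps eval_nat_numeral)
  have snz: "s n \<noteq> 0" if "n \<ge> 1" for n
    using nz[OF that] by (simp add: s_def)
  have "somos_at (s 2) (s 3) (to_fract g) s k"
    unfolding somos_at_def
    using somos_of_nonzero[of s, OF init(1,2) odd even \<gamma> snz] by blast
  then have *: "somos_at (to_fract b) (to_fract c) (to_fract g) s k"
    unfolding s eds_initial .
  have eq: "x = y \<longleftrightarrow> to_fract x = to_fract y" for x y :: 'a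
    by simp
  show ?thesis
    using * unfolding somos_at_def eq hom_simps s_def .
qed

text \<open>Over $\mathbb{Z}[b, c, \gamma]$, a domain of characteristic zero, no term of positive index vanishes,
  and every triple of parameters in a commutative ring is the image of the three variables. So the
  relations also hold for sequences that do have zeros.\<close>

lemma eds_somos:
  fixes b c g :: "'a::comm_ring_1"
  shows "somos_at b c g (eds b c (g * c - b ^ 4)) k"
proof -
  define B C G :: "int poly poly poly" where "B = [:[:[:0, 1:]:]:]" and "C = [:[:0, 1:]:]" and "G = [:0, 1:]"
  have ev: "\<exists>h. type_ring_hom h \<and> h B = x \<and> h C = y \<and> h G = z" for x y z :: "'r::comm_ring_1"
  proof -
    define h1 where "h1 p = poly (map_poly of_int p) x" for p
    define h2 where "h2 p = poly (map_poly h1 p) y" for p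
    define h3 where "h3 p = poly (map_poly h2 p) z" for p
    interpret h0: type_ring_hom "of_int :: int \<Rightarrow> 'r" by (rule of_int_type_ring_hom)
    interpret h1: type_ring_hom h1 unfolding h1_def by (rule h0.poly_map_hom)
    interpret h2: type_ring_hom h2 unfolding h2_def by (rule h1.poly_map_hom)
    interpret h3: type_ring_hom h3 unfolding h3_def by (rule h2.poly_map_hom)
    have "h3 B = x" "h3 C = y" "h3 G = z"
      unfolding B_def C_def G_def h3_def h2.poly_map_pCons
      unfolding h2_def h1.poly_map_pCons
      unfolding h1_def h0.poly_map_pCons
      by simp_all
    then show ?thesis using h3.type_ring_hom_axioms by blast
  qed
  \<comment> \<open>The values \<open>2, 3, 6\<close> give the fourth parameter \<open>6 * 3 - 2 ^ 4 = 2\<close>.\<close>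
  have nz: "eds B C (G * C - B ^ 4) n \<noteq> 0" if "n \<ge> 1" for n
  proof -
    obtain h :: "int poly poly poly \<Rightarrow> int" where h: "type_ring_hom h" "h B = 2" "h C = 3" "h G = 6"
      using ev by blast
    interpret type_ring_hom h by (rule h(1))
    have "h (eds B C (G * C - B ^ 4) n) = int n"
      unfolding hom_eds hom_simps h(2-) using eds_2_3_2 by simp
    then show ?thesis using that hom_zero by auto
  qed
  obtain h :: "int poly poly poly \<Rightarrow> 'a" where h: "type_ring_hom h" "h B = b" "h C = c" "h G = g"
    using ev by blast
  interpret type_ring_hom h by (rule h(1))
  show ?thesis
    using hom_somos_at[OF eds_somos_idom[OF nz]] unfolding hom_eds hom_simps h(2-) .
qed

section \<open>Multiples of a point on a Weierstrass curve\<close>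

text \<open>The sequence \<open>t\<close> is the sequence $s$ shifted by one, $t_k = s_{k-1}$, so that it can start
  with $s_{-1} = -1$ and \<open>k\<close> stays a natural number. The window at \<open>k\<close> is centred at $s_{k+1}$, and
  the point is $[k+1](u, v)$.\<close>

definition somos_point :: "'a::field \<Rightarrow> 'a \<Rightarrow> (nat \<Rightarrow> 'a) \<Rightarrow> nat \<Rightarrow> 'a wpoint" where
  "somos_point u v t k =
     (if t (k + 2) = 0 then Infinity
      else Affine (u - t (k + 1) * t (k + 3) / t (k + 2)^2)
             ((t (k + 4) * t (k + 1)^2 - t k * t (k + 3)^2) / (4 * v * t (k + 2)^3)))"

text \<open>If $t_{k+3} = t_{k+4} = 0$, the second relation becomes $0 = - b^2 t_{k+2}^3$. So a pair of
  consecutive zeros would move down until it meets $t_2 \neq 0$.\<close>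

lemma somos_no_consecutive_zeros:
  fixes t :: "nat \<Rightarrow> 'a::field"
  assumes somos: "\<And>k. somos_at b c g t k" and "b \<noteq> 0" "t 2 \<noteq> 0"
  shows "t (k + 1) \<noteq> 0 \<or> t (k + 2) \<noteq> 0"
proof (induction k)
  case 0
  then show ?case using \<open>t 2 \<noteq> 0\<close> by (simp add: numeral_2_eq_2)
next
  case (Suc k)
  show ?case
  proof (cases k)
    case 0
    then show ?thesis using \<open>t 2 \<noteq> 0\<close> by (simp add: numeral_2_eq_2)
  next
    case (Suc j)
    then show ?thesis
      using Suc.IH somos[of j] \<open>b \<noteq> 0\<close> by (auto simp: somos_at_def numeral_eq_Suc)
  qed
qed

text \<open>Write $z$, $p$, $q$ for the differences \<open>u - u(R)\<close>, \<open>u - u(R + Q)\<close> and \<open>u - u(R - Q)\<close>, where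
  \<open>Q = (u, v)\<close>. The second coordinate of \<open>R\<close> is $z^2(p - q)/(4v)$, because the chords of \<open>R\<close> with \<open>Q\<close> and \<open>-Q\<close>
  have slopes whose squares differ by \<open>p - q\<close> up to sign. With Vieta's formulas, the slope of the
  chord is $(g - 2zp)/(4v)$, and the rest is the biquadratic equation between \<open>z\<close> and \<open>p\<close>.\<close>

lemma chord_addition:
  fixes u v z p q :: "'a::field"
  assumes two: "(2::'a) \<noteq> 0" and "v \<noteq> 0" "z \<noteq> 0" and c: "4 * c = 48 * u * v^2 - g^2"
    and sum: "z^2 * (p + q) = g * z - (2 * v)^2" and prod: "z^2 * (p * q) = (2 * v)^2 * z - c"
  shows "w_add A (Affine u v) (Affine (u - z) (z^2 * (p - q) / (4 * v))) =
    Affine (u - p) ((((2 * v)^2 * p - c) / z - p^2 * z) / (4 * v))"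
proof -
  have "(2::'a) * 2 \<noteq> 0" using two by (intro no_zero_divisors)
  then have four: "(4::'a) \<noteq> 0" by simp
  have "(4::'a) * 4 \<noteq> 0" using four by (intro no_zero_divisors)
  then have sixteen: "(16::'a) \<noteq> 0" by simp
  define l where "l = (g - 2 * z * p) / (4 * v)"
  have bi: "z^2 * p^2 = g * z * p - (2 * v)^2 * (z + p) + c"
  proof -
    have "z^2 * p^2 = p * (z^2 * (p + q)) - z^2 * (p * q)"
      by (simp add: algebra_simps power2_eq_square)
    also have "\<dots> = g * z * p - (2 * v)^2 * (z + p) + c"
      unfolding sum prod by (simp add: algebra_simps power2_eq_square)
    finally show ?thesis .
  qed
  have "z^2 * (p - q) = 2 * (z^2 * p) - z^2 * (p + q)"
    by (simp add: algebra_simps)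
  then have diff: "z^2 * (p - q) = 4 * v * v - z * (g - 2 * z * p)"
    unfolding sum by (simp add: algebra_simps power2_eq_square)
  have slope: "(z^2 * (p - q) / (4 * v) - v) / (u - z - u) = l"
    unfolding diff l_def using four assms(2,3) by (simp add: field_simps)
  have "(g - 2 * z * p)^2 = g^2 - 4 * (g * z * p) + 4 * (z^2 * p^2)"
    by (simp add: algebra_simps power2_eq_square)
  also have "\<dots> = (g^2 + 4 * c) - 16 * v^2 * (z + p)"
    unfolding bi by (simp add: algebra_simps power2_eq_square)
  also have "\<dots> = 16 * v^2 * (3 * u - z - p)"
    unfolding c by (simp add: algebra_simps)
  finally have sq: "(g - 2 * z * p)^2 = 16 * v^2 * (3 * u - z - p)" .
  have "l^2 = (16 * v^2 * (3 * u - z - p)) / (16 * v^2)"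
    unfolding l_def power_divide sq by (simp add: power_mult_distrib)
  then have "l^2 = 3 * u - z - p"
    using sixteen assms(2) by simp
  then have x: "l^2 - u - (u - z) = u - p"
    by simp
  have "(g * p - 2 * z * p^2 - 4 * v^2) * z = (2 * v)^2 * p - c - p^2 * z^2"
  proof -
    have "(g * p - 2 * z * p^2 - 4 * v^2) * z = g * z * p - (2 * v)^2 * z - 2 * (z^2 * p^2)"
      by (simp add: algebra_simps power2_eq_square)
    also have "\<dots> = (2 * v)^2 * p - c - z^2 * p^2"
      using bi by (simp add: algebra_simps)
    finally show ?thesis by (simp add: mult.commute)
  qed
  then have "g * p - 2 * z * p^2 - 4 * v^2 = ((2 * v)^2 * p - c - p^2 * z^2) / z"
    using assms(3) by (simp add: field_simps)
  also have "\<dots> = ((2 * v)^2 * p - c) / z - p^2 * z"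
    using assms(3) by (simp add: field_simps power2_eq_square)
  finally have y': "g * p - 2 * z * p^2 - 4 * v^2 = ((2 * v)^2 * p - c) / z - p^2 * z" .
  have "l * p - v = (g * p - 2 * z * p^2 - 4 * v^2) / (4 * v)"
    unfolding l_def using four assms(2) by (simp add: field_simps power2_eq_square)
  then have y: "l * (u - (u - p)) - v = (((2 * v)^2 * p - c) / z - p^2 * z) / (4 * v)"
    unfolding y' by simp
  have "u \<noteq> u - z" using assms(3) by simp
  then show ?thesis
    unfolding w_add.simps Let_def
    by (simp only: slope x y if_False simp_thms)
qed

text \<open>The cases of the addition law correspond to the zeros of the window: the point is at infinity if
  the middle term is zero, it is \<open>-Q\<close> if the next term is zero, and it is \<open>Q\<close> if the previous
  term is zero, which calls for the tangent. Otherwise the ratios $z$, $p$, $q$ are defined and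
  satisfy Vieta's formulas. The condition on \<open>c\<close> says that it is the third division polynomial of $v^2 = u^3 + Au + B$:
  with $g = 6u^2 + 2A$, the difference of $12u(2v)^2$ and $g^2$ is
  $4(3u^4 + 6Au^2 + 12Bu - A^2)$.\<close>

lemma w_add_somos_point:
  fixes t :: "nat \<Rightarrow> 'a::field"
  assumes two: "(2::'a) \<noteq> 0" and v: "v \<noteq> 0" and g: "g = 6 * u^2 + 2 * A"
    and c: "4 * c = 48 * u * v^2 - g^2"
    and somos: "somos_at (2 * v) c g t k" "somos_at (2 * v) c g t (k + 1)"
    and nz: "t (k + 1) \<noteq> 0 \<or> t (k + 2) \<noteq> 0" "t (k + 2) \<noteq> 0 \<or> t (k + 3) \<noteq> 0"
  shows "w_add A (Affine u v) (somos_point u v t k) = somos_point u v t (k + 1)"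
proof -
  define x0 x1 x2 x3 x4 x5 where "x0 = t k" and "x1 = t (k + 1)" and "x2 = t (k + 2)"
    and "x3 = t (k + 3)" and "x4 = t (k + 4)" and "x5 = t (k + 5)"
  note x = x0_def x1_def x2_def x3_def x4_def x5_def
  have idx: "k + 1 + 1 = k + 2" "k + 1 + 2 = k + 3" "k + 1 + 3 = k + 4" "k + 1 + 4 = k + 5"
    by simp_all
  have r: "x4 * x0 = (2 * v)^2 * (x3 * x1) - c * x2^2"
    "x4 * x1^2 + x0 * x3^2 = (g * x1 * x3 - (2 * v)^2 * x2^2) * x2"
    "x5 * x1 = (2 * v)^2 * (x4 * x2) - c * x3^2"
    "x5 * x2^2 + x1 * x4^2 = (g * x2 * x4 - (2 * v)^2 * x3^2) * x3"
    using somos unfolding somos_at_def idx x by blast+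
  have pt: "somos_point u v t k = (if x2 = 0 then Infinity
      else Affine (u - x1 * x3 / x2^2) ((x4 * x1^2 - x0 * x3^2) / (4 * v * x2^3)))"
    "somos_point u v t (k + 1) = (if x3 = 0 then Infinity
      else Affine (u - x2 * x4 / x3^2) ((x5 * x2^2 - x1 * x4^2) / (4 * v * x3^3)))"
    unfolding somos_point_def idx x by (rule refl)+
  have "(2::'a) * 2 \<noteq> 0" using two by (intro no_zero_divisors)
  then have four: "(4::'a) \<noteq> 0" by simp
  have "(4::'a) * 4 \<noteq> 0" using four by (intro no_zero_divisors)
  then have sixteen: "(16::'a) \<noteq> 0" by simp
  consider (inf) "x2 = 0" "x1 \<noteq> 0" "x3 \<noteq> 0" | (opp) "x2 \<noteq> 0" "x3 = 0"
    | (tangent) "x2 \<noteq> 0" "x3 \<noteq> 0" "x1 = 0" | (chord) "x2 \<noteq> 0" "x3 \<noteq> 0" "x1 \<noteq> 0"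
    using nz unfolding x by blast
  then show ?thesis
  proof cases
    case inf
    then have "x1 * x4^2 = - (4 * v * v * x3^3)"
      using r(4) by (simp add: power2_eq_square power3_eq_cube)
    then show ?thesis
      unfolding pt using inf four v by simp
  next
    case opp
    then have "x4 * x1^2 = - (v * (4 * v * x2^3))"
      using r(2) by (simp add: power2_eq_square power3_eq_cube)
    then show ?thesis
      unfolding pt using opp four v by simp
  next
    case tangent
    then have "x0 * x3^2 = - (v * (4 * v * x2^3))"
      using r(2) by (simp add: power2_eq_square power3_eq_cube)
    then have pt1: "somos_point u v t k = Affine u v"
      unfolding pt using tangent four v by simp
    define e where "e = x2 * x4 / x3^2"
    have e4: "(2 * v)^2 * e = c"
      using r(3) tangent unfolding e_def by (simp add: field_simps)
    have "x5 * x2^2 = (g * x2 * x4 - (2 * v)^2 * x3^2) * x3"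
      using r(4) tangent by simp
    then have "(x5 * x2^2 - x1 * x4^2) / (4 * v * x3^3) = (g * e - (2 * v)^2) / (4 * v)"
      unfolding e_def using tangent four v by (simp add: field_simps power2_eq_square power3_eq_cube)
    then have pt2: "somos_point u v t (k + 1) = Affine (u - e) ((g * e - (2 * v)^2) / (4 * v))"
      unfolding pt e_def using tangent by simp
    define l where "l = (3 * u^2 + A) / (2 * v)"
    have l: "l = g / (4 * v)"
      unfolding l_def g using two four v by (simp add: field_simps)
    have "16 * v^2 * (l^2) = g^2"
      unfolding l using sixteen v by (simp add: power_divide power_mult_distrib)
    also have "\<dots> = 16 * v^2 * (3 * u - e)"
      using c unfolding e4[symmetric] by (simp add: algebra_simps power2_eq_square)
    finally have "l^2 = 3 * u - e"
      using sixteen v by simp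
    then have X: "l^2 - u - u = u - e" by simp
    have Y: "l * (u - (u - e)) - v = (g * e - (2 * v)^2) / (4 * v)"
      unfolding l using four v by (simp add: field_simps power2_eq_square)
    have "v + v \<noteq> 0" using two v by (metis mult_2 no_zero_divisors)
    then have "v \<noteq> - v" by (simp add: eq_neg_iff_add_eq_0)
    then show ?thesis
      unfolding pt1 pt2 w_add.simps Let_def l_def[symmetric] by (simp only: X Y if_False if_True simp_thms)
  next
    case chord
    define z p q where "z = x1 * x3 / x2^2" and "p = x2 * x4 / x3^2" and "q = x0 * x2 / x1^2"
    have z: "z \<noteq> 0" using chord by (simp add: z_def)
    have "z^2 * (p + q) = (x4 * x1^2 + x0 * x3^2) / x2^3"
      unfolding z_def p_def q_def using chord by (simp add: field_simps power2_eq_square power3_eq_cube)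
    also have "\<dots> = g * z - (2 * v)^2"
      unfolding r z_def using chord by (simp add: field_simps power2_eq_square power3_eq_cube)
    finally have sum: "z^2 * (p + q) = g * z - (2 * v)^2" .
    have "z^2 * (p * q) = (x4 * x0) / x2^2"
      unfolding z_def p_def q_def using chord by (simp add: field_simps power2_eq_square power3_eq_cube)
    also have "\<dots> = (2 * v)^2 * z - c"
      unfolding r z_def using chord by (simp add: field_simps)
    finally have prod: "z^2 * (p * q) = (2 * v)^2 * z - c" .
    have "z^2 * (p - q) = (x4 * x1^2 - x0 * x3^2) / x2^3"
      unfolding z_def p_def q_def using chord by (simp add: field_simps power2_eq_square power3_eq_cube)
    then have pt1: "somos_point u v t k = Affine (u - z) (z^2 * (p - q) / (4 * v))"
      unfolding pt using chord by (simp add: z_def mult.commute)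
    have "((2 * v)^2 * p - c) / z = (x5 * x1) * x2^2 / (x1 * x3^3)"
      unfolding r z_def p_def using chord by (simp add: field_simps power2_eq_square power3_eq_cube)
    then have "((2 * v)^2 * p - c) / z - p^2 * z = (x5 * x2^2 - x1 * x4^2) / x3^3"
      unfolding z_def p_def using chord by (simp add: field_simps power2_eq_square power3_eq_cube)
    then have pt2: "somos_point u v t (k + 1) =
        Affine (u - p) ((((2 * v)^2 * p - c) / z - p^2 * z) / (4 * v))"
      unfolding pt using chord by (simp add: p_def mult.commute)
    show ?thesis
      unfolding pt1 pt2 by (rule chord_addition[OF two v z c sum prod])
  qed
qed

text \<open>Prefixing $s_{-1} = -1$ keeps the five-term relations true, as they hold for the initial values, and
  gives a window centred at $s_1$, where the induction on the multiples starts with $[1]Q = Q$.\<close>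

lemma w_mult_eq_Infinity_iff_eds:
  fixes u v A g c :: "'a::field"
  assumes two: "(2::'a) \<noteq> 0" and v: "v \<noteq> 0" and g: "g = 6 * u^2 + 2 * A"
    and c: "4 * c = 48 * u * v^2 - g^2" and "n \<ge> 1"
  shows "w_mult A n (Affine u v) = Infinity \<longleftrightarrow> eds (2 * v) c (g * c - (2 * v)^4) n = 0"
proof -
  define s where "s = eds (2 * v) c (g * c - (2 * v)^4)"
  define t where "t k = (case k of 0 \<Rightarrow> - 1 | Suc n \<Rightarrow> s n)" for k
  have t: "t 0 = - 1" "t (Suc n) = s n" for n
    by (simp_all add: t_def)
  have s: "s 0 = 0" "s 1 = 1" "s 2 = 2 * v" "s 3 = c"
    unfolding s_def eds_initial by (rule refl)+
  have t4: "t 1 = 0" "t 2 = 1" "t 3 = 2 * v" "t 4 = c"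
    unfolding numeral_eq_Suc using t(2)[of 0] t(2)[of 1] t(2)[of 2] t(2)[of 3] s
    by (simp_all add: numeral_eq_Suc)
  have somos: "somos_at (2 * v) c g t k" for k
  proof (cases k)
    case 0
    then show ?thesis
      using t t4 by (simp add: somos_at_def numeral_eq_Suc)
  next
    case (Suc j)
    have "t (Suc j + i) = s (j + i)" "t (Suc j) = s j" for i
      by (simp_all add: t)
    then show ?thesis
      using eds_somos[of "2 * v" c g j, folded s_def] unfolding Suc somos_at_def by (simp only:)
  qed
  have nz: "t (k + 1) \<noteq> 0 \<or> t (k + 2) \<noteq> 0" for k
    by (rule somos_no_consecutive_zeros[OF somos]) (use t4 two v in simp_all)
  have "w_mult A (k + 1) (Affine u v) = somos_point u v t k" for k
  proof (induction k)
    case 0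
    have "(2::'a) * 2 \<noteq> 0" using two by (intro no_zero_divisors)
    then have four: "(4::'a) \<noteq> 0" by simp
    then show ?case
      using v t t4 by (simp add: somos_point_def numeral_eq_Suc power2_eq_square)
  next
    case (Suc k)
    have "w_mult A (Suc k + 1) (Affine u v) = w_add A (Affine u v) (w_mult A (k + 1) (Affine u v))"
      by simp
    also have "\<dots> = somos_point u v t (k + 1)"
      unfolding Suc.IH
    proof (rule w_add_somos_point[OF two v g c somos somos nz])
      show "t (k + 2) \<noteq> 0 \<or> t (k + 3) \<noteq> 0"
        using nz[of "k + 1"] by (simp add: numeral_eq_Suc)
    qed
    finally show ?case by simp
  qed
  from this[of "n - 1"] have "w_mult A n (Affine u v) = somos_point u v t (n - 1)"
    using \<open>n \<ge> 1\<close> by simp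
  moreover have "t (n - 1 + 2) = s n"
    using t(2)[of n] \<open>n \<ge> 1\<close> by (simp add: numeral_eq_Suc)
  ultimately show ?thesis
    by (simp add: somos_point_def s_def)
qed

section \<open>The Edwards polynomial is prime\<close>

lemma to_ac_type_ring_hom: "type_ring_hom to_ac"
  by standard simp_all

text \<open>Let \<open>r\<close> be a root of $1 - a X^2$ in the algebraic closure. It is a simple root, and not a root of
  $1 - d X^2$. So the order of vanishing at \<open>r\<close> is even on the left and odd on the right.\<close>

lemma edwards_quotient_not_square:
  fixes a d :: "'k::field"
  assumes two: "(2::'k) \<noteq> 0" and "a \<noteq> 0" "a \<noteq> d"
    and eq: "[:1, 0, - d:] * p^2 = [:1, 0, - a:] * q^2"
  shows "p = 0 \<and> q = 0"
proof (rule ccontr)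
  assume nz: "\<not> (p = 0 \<and> q = 0)"
  have N: "[:1, 0, - a:] \<noteq> 0" and D: "[:1, 0, - d:] \<noteq> 0"
    by simp_all
  have pq: "p \<noteq> 0" "q \<noteq> 0"
  proof -
    show "p \<noteq> 0"
    proof
      assume "p = 0"
      then have "[:1, 0, - a:] * q^2 = 0" using eq by simp
      then show False using nz N \<open>p = 0\<close> by (simp only: mult_eq_0_iff power_eq_0_iff) simp
    qed
    show "q \<noteq> 0"
    proof
      assume "q = 0"
      then have "[:1, 0, - d:] * p^2 = 0" using eq by simp
      then show False using nz D \<open>q = 0\<close> by (simp only: mult_eq_0_iff power_eq_0_iff) simp
    qed
  qed
  interpret m: type_ring_hom "map_poly (to_ac :: 'k \<Rightarrow> _)"
    by (intro type_ring_hom.map_poly_hom to_ac_type_ring_hom)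
  define P Q where "P = map_poly to_ac p" and "Q = map_poly to_ac q"
  have PQ: "P \<noteq> 0" "Q \<noteq> 0"
    using pq by (simp_all add: P_def Q_def map_poly_eq_0_iff)
  obtain r where r: "r^2 = inverse (to_ac a)"
    using nth_root_exists[of 2 "inverse (to_ac a)"] by auto
  have ar: "to_ac a * r^2 = 1"
    using \<open>a \<noteq> 0\<close> by (simp add: r)
  then have "r \<noteq> 0" by auto
  have num: "(2::'k alg_closure) \<noteq> 0"
    using two to_ac_eq_0_iff[of "2::'k"] by simp
  have factor: "[:1, 0, - to_ac a:] = [:- r, 1:] * [:- (to_ac a * r), - to_ac a:]"
    using ar by (simp add: algebra_simps power2_eq_square)
  have "[:1, 0, - to_ac d:] * P^2 = [:1, 0, - to_ac a:] * Q^2"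
    using arg_cong[OF eq, of "map_poly to_ac"]
    unfolding m.hom_simps P_def Q_def by (simp add: map_poly_pCons)
  then have eq': "[:1, 0, - to_ac d:] * P^2 = [:- r, 1:] * [:- (to_ac a * r), - to_ac a:] * Q^2"
    unfolding factor .
  have 1: "order r [:1, 0, - to_ac d:] = 0"
  proof (rule order_0I)
    have "r^2 * to_ac (a - d) \<noteq> 0"
      using \<open>r \<noteq> 0\<close> \<open>a \<noteq> d\<close> by (simp del: to_ac_diff)
    then have "1 - to_ac d * r^2 \<noteq> 0"
      using ar by (simp add: algebra_simps)
    then show "poly [:1, 0, - to_ac d:] r \<noteq> 0"
      by (simp add: algebra_simps power2_eq_square)
  qed
  have 2: "order r [:- (to_ac a * r), - to_ac a:] = 0"
  proof (rule order_0I)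
    have "poly [:- (to_ac a * r), - to_ac a:] r = - (2 * (to_ac a * r))"
      by (simp add: algebra_simps)
    then show "poly [:- (to_ac a * r), - to_ac a:] r \<noteq> 0"
      using \<open>r \<noteq> 0\<close> \<open>a \<noteq> 0\<close> num by simp
  qed
  have 3: "order r [:- r, 1:] = 1"
    using order_power_n_n[of r 1] by simp
  have nz: "[:1, 0, - to_ac d:] \<noteq> 0" "[:- r, 1:] \<noteq> 0" "[:- (to_ac a * r), - to_ac a:] \<noteq> 0"
    using \<open>a \<noteq> 0\<close> by simp_all
  have "order r ([:1, 0, - to_ac d:] * P^2) = 2 * order r P"
    using PQ nz by (simp add: order_mult 1 power2_eq_square del: mult_pCons_left)
  moreover have "order r ([:- r, 1:] * [:- (to_ac a * r), - to_ac a:] * Q^2) = 1 + 2 * order r Q"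
  proof -
    have "[:- r, 1:] * [:- (to_ac a * r), - to_ac a:] \<noteq> 0" "Q^2 \<noteq> 0" "Q * Q \<noteq> 0"
      using nz PQ by (simp_all only: mult_eq_0_iff power_eq_0_iff simp_thms)
    then have "order r ([:- r, 1:] * [:- (to_ac a * r), - to_ac a:] * Q^2) =
        order r [:- r, 1:] + order r [:- (to_ac a * r), - to_ac a:] + (order r Q + order r Q)"
      unfolding power2_eq_square using nz by (simp only: order_mult mult_eq_0_iff simp_thms)
    then show ?thesis unfolding 2 3 by simp
  qed
  ultimately have "2 * order r P = 1 + 2 * order r Q"
    unfolding eq' by simp
  then show False by presburger
qed

text \<open>The form $D y^2 - N$ in \<open>k[x][y]\<close> allows division with remainder by this polynomial up to powers
  of \<open>D\<close>. The letters $D = 1 - d x^2$ and $N = 1 - a x^2$ keep this meaning below.\<close>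

lemma edwards_poly_altdef: "edwards_poly a d = [:- [:1, 0, - a:], 0, [:1, 0, - d:]:]"
  by (simp add: edwards_poly_def polyC_def polyX_def polyY_def power2_eq_square one_pCons)

text \<open>Modulo \<open>D\<close> the Edwards polynomial is the constant \<open>-N\<close>, and $a D - d N = a - d$ makes \<open>N\<close> a unit
  there. So if \<open>D G = f h\<close> then \<open>D\<close> divides \<open>h\<close>.\<close>

lemma edwards_poly_dvd_smultD:
  fixes a d :: "'k::field"
  assumes "a \<noteq> d" and dvd: "edwards_poly a d dvd smult ([:1, 0, - d:] ^ m) g"
  shows "edwards_poly a d dvd g"
  using dvd
proof (induction m)
  case 0
  then show ?case by simp
next
  case (Suc m)
  define N D G where "N = [:1, 0, - a:]" and "D = [:1, 0, - d:]" and "G = smult (D ^ m) g"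
  have "D \<noteq> 0" by (simp add: D_def)
  have f: "edwards_poly a d = [:- N, 0, D:]"
    by (simp add: edwards_poly_altdef N_def D_def)
  obtain h where h: "smult D G = edwards_poly a d * h"
    using Suc.prems by (auto simp: D_def G_def elim: dvdE)
  define y2h where "y2h = pCons 0 (pCons 0 h)"
  have N: "smult N h = smult D (y2h - G)"
    unfolding smult_diff_right h f y2h_def by simp
  have "[:a - d:] = [:a:] * D - [:d:] * N"
    by (simp add: D_def N_def)
  then have "smult [:a - d:] h = smult ([:a:] * D) h - smult ([:d:] * N) h"
    by (simp only: smult_diff_left)
  also have "smult ([:a:] * D) h = smult D (smult [:a:] h)"
    by (simp only: smult_smult mult.commute)
  also have "smult ([:d:] * N) h = smult D (smult [:d:] (y2h - G))"
    by (simp only: smult_smult[symmetric] N) (simp only: smult_smult mult.commute)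
  finally have "smult [:inverse (a - d):] (smult [:a - d:] h) =
      smult [:inverse (a - d):] (smult D (smult [:a:] h) - smult D (smult [:d:] (y2h - G)))"
    by simp
  also have "smult [:inverse (a - d):] (smult [:a - d:] h) = h"
    using \<open>a \<noteq> d\<close> by (simp add: one_pCons[symmetric])
  also have "smult [:inverse (a - d):] (smult D (smult [:a:] h) - smult D (smult [:d:] (y2h - G))) =
      smult D (smult [:inverse (a - d):] (smult [:a:] h - smult [:d:] (y2h - G)))"
    by (simp only: smult_diff_right[symmetric]) (simp only: smult_smult mult.commute)
  finally obtain H where H: "h = smult D H" by blast
  have "smult D (G - edwards_poly a d * H) = 0"
    unfolding smult_diff_right h by (simp add: H)
  then have "G = edwards_poly a d * H"
    using \<open>D \<noteq> 0\<close> by simp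
  then show ?case
    using Suc.IH by (simp add: G_def D_def)
qed

text \<open>By pseudo-division, and as powers of \<open>D\<close> can be cancelled, \<open>p\<close> and \<open>q\<close> may be replaced by
  remainders $r_0 + r_1 y$ and $s_0 + s_1 y$. Their product is divisible by \<open>D y^2 - N\<close> only if
  $D r_0 s_0 = - N r_1 s_1$ and $r_0 s_1 = - r_1 s_0$. If neither remainder is zero, these give
  $D r_0^2 = N r_1^2$ with $r_1 \neq 0$, which is impossible.\<close>

lemma edwards_poly_prime:
  fixes a d :: "'k::field"
  assumes two: "(2::'k) \<noteq> 0" and "a \<noteq> 0" "a \<noteq> d"
    and dvd: "edwards_poly a d dvd p * q"
  shows "edwards_poly a d dvd p \<or> edwards_poly a d dvd q"
proof -
  define N D f where "N = [:1, 0, - a:]" and "D = [:1, 0, - d:]" and "f = edwards_poly a d"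
  have D0: "D \<noteq> 0" by (simp add: D_def)
  have f: "f = [:- N, 0, D:]"
    by (simp add: edwards_poly_altdef N_def D_def f_def)
  then have deg: "degree f = 2" "coeff f (degree f) = D" "f \<noteq> 0"
    using D0 by simp_all
  have reduce: "\<exists>m h r0 r1. smult (D ^ m) p = f * h + [:r0, r1:]" for p
  proof -
    obtain h r where hr: "pseudo_divmod p f = (h, r)" by fastforce
    note pd = pseudo_divmod[OF deg(3) hr]
    have "degree r \<le> 1" using pd(2) deg by auto
    then have "r = [:coeff r 0, coeff r 1:]"
      by (intro poly_eqI) (auto simp: coeff_pCons coeff_eq_0 split: nat.split)
    then show ?thesis using pd(1) unfolding deg(2) by metis
  qed
  obtain m h r0 r1 where r: "smult (D ^ m) p = f * h + [:r0, r1:]" using reduce by blast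
  obtain l h' s0 s1 where s: "smult (D ^ l) q = f * h' + [:s0, s1:]" using reduce by blast
  have "f dvd smult (D ^ m) p * smult (D ^ l) q"
    using dvd by (simp add: f_def mult.commute dvd_smult)
  also have "smult (D ^ m) p * smult (D ^ l) q =
      f * (h * smult (D ^ l) q + [:r0, r1:] * h') + [:r0, r1:] * [:s0, s1:]"
    unfolding r s by (simp add: algebra_simps)
  finally have "f dvd [:r0, r1:] * [:s0, s1:]"
    by (simp add: dvd_add_right_iff)
  then have "f dvd smult D ([:r0, r1:] * [:s0, s1:]) - smult (r1 * s1) f"
    by (intro dvd_diff dvd_smult) simp_all
  also have "smult D ([:r0, r1:] * [:s0, s1:]) - smult (r1 * s1) f =
      [:D * r0 * s0 + N * r1 * s1, D * (r0 * s1 + r1 * s0):]"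
    unfolding f by (simp add: algebra_simps)
  finally have dvd': "f dvd [:D * r0 * s0 + N * r1 * s1, D * (r0 * s1 + r1 * s0):]" .
  have "[:D * r0 * s0 + N * r1 * s1, D * (r0 * s1 + r1 * s0):] = 0"
  proof (rule ccontr)
    assume "[:D * r0 * s0 + N * r1 * s1, D * (r0 * s1 + r1 * s0):] \<noteq> 0"
    then have "2 \<le> degree [:D * r0 * s0 + N * r1 * s1, D * (r0 * s1 + r1 * s0):]"
      using dvd_imp_degree_le[OF dvd'] deg(1) by simp
    then show False by (simp split: if_splits)
  qed
  then have e1: "D * r0 * s0 = - (N * r1 * s1)" and e2: "r0 * s1 = - (r1 * s0)"
    using D0 by (simp_all add: eq_neg_iff_add_eq_0)
  have "[:r0, r1:] = 0 \<or> [:s0, s1:] = 0"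
  proof (cases "r1 = 0")
    case True
    then show ?thesis using e1 e2 D0 by auto
  next
    case False
    have "s1 * (D * r0^2) = D * r0 * (r0 * s1)"
      by (simp add: power2_eq_square mult_ac)
    also have "\<dots> = - (r1 * (D * r0 * s0))"
      unfolding e2 by (simp add: mult_ac)
    also have "\<dots> = s1 * (N * r1^2)"
      unfolding e1 by (simp add: power2_eq_square mult_ac)
    finally have "s1 = 0 \<or> D * r0^2 = N * r1^2"
      by (simp only: mult_cancel_left)
    then have "s1 = 0"
      using edwards_quotient_not_square[OF two \<open>a \<noteq> 0\<close> \<open>a \<noteq> d\<close>, of r0 r1] False
      unfolding D_def N_def by blast
    then show ?thesis using e2 False by simp
  qed
  then have "f dvd smult (D ^ m) p \<or> f dvd smult (D ^ l) q"
    unfolding r s by (elim disjE) (simp_all only: add_0_right dvd_triv_left, simp_all)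
  then show ?thesis
    unfolding f_def D_def using edwards_poly_dvd_smultD[OF \<open>a \<noteq> d\<close>] by blast
qed

section \<open>The first division polynomials on the Edwards curve\<close>

text \<open>Here \<open>(u, v)\<close> is the image of \<open>(x, y)\<close> on the Weierstrass curve, $c = \psi_3$ and
  $g = 6u^2 + 2A$ in terms of \<open>y\<close>. The last two equations say that $\psi_2 = 2v$ and that $\psi_4$
  is the fourth term of the sequence with these parameters. Squares of \<open>x\<close> are eliminated by
  $x^2 (a - d y^2) = 1 - y^2$. What is left are polynomial identities in \<open>a\<close>, \<open>d\<close> and \<open>y\<close> over a power
  of \<open>1 - y\<close>.\<close>

lemma edwards_division_values:
  fixes a d x y :: "'f::field"
  assumes two: "(2::'f) \<noteq> 0" and three: "(3::'f) \<noteq> 0"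
    and E: "a * x^2 + y^2 = 1 + d * x^2 * y^2" and nz: "x \<noteq> 0" "1 - y \<noteq> 0" "1 + y \<noteq> 0" and "a \<noteq> d"
  defines "u \<equiv> ((5 * a - d) + (a - 5 * d) * y) / (12 * (1 - y))"
    and "v \<equiv> ((a - d) * (1 + y)) / (4 * x * (1 - y))"
    and "c \<equiv> (a - d)^3 * (a + 2 * a * y - 2 * d * y^3 - d * y^4) / (2 * (1 - y))^4"
    and "g \<equiv> (a - d) * (2 * a + (a - d) * y - 2 * d * y^2) / (2 * (1 - y)^2)"
  shows "v \<noteq> 0" "g = 6 * u^2 + 2 * edwards_wA a d" "4 * c = 48 * u * v^2 - g^2"
    "2 * v = (a - d) * (1 + y) / (x * (2 * (1 - y)))"
    "2 * v * (g * c - (2 * v)^4) =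
      2 * (a - d)^6 * y * (1 + y) * (a - d * y^4) / (x * (2 * (1 - y))^7)"
proof -
  define w where "w = 1 - y"
  have w: "w \<noteq> 0" using nz by (simp add: w_def)
  have prime_factors: "(2::'f) ^ i * 3 ^ j \<noteq> 0" for i j
    using two three by simp
  \<comment> \<open>Denominators of the form $2^i 3^j$ that occur when fractions are combined below.\<close>
  have num: "(4::'f) \<noteq> 0" "(12::'f) \<noteq> 0" "(16::'f) \<noteq> 0" "(32::'f) \<noteq> 0" "(24::'f) \<noteq> 0" "(48::'f) \<noteq> 0"
    "(64::'f) \<noteq> 0" "(128::'f) \<noteq> 0" "(144::'f) \<noteq> 0"
    "(512::'f) \<noteq> 0" "(6912::'f) \<noteq> 0"
    using prime_factors[of 2 0] prime_factors[of 2 1] prime_factors[of 4 0] prime_factors[of 5 0]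
      prime_factors[of 3 1] prime_factors[of 4 1] prime_factors[of 6 0] prime_factors[of 7 0]
      prime_factors[of 4 2] prime_factors[of 9 0] prime_factors[of 8 3] by simp_all
  show v0: "v \<noteq> 0"
    using nz num \<open>a \<noteq> d\<close> by (simp add: v_def)
  have v2: "2 * v = (a - d) * (1 + y) / (2 * x * w)"
    unfolding v_def w_def[symmetric] using nz num two w by (simp add: field_simps)
  then show "2 * v = (a - d) * (1 + y) / (x * (2 * (1 - y)))"
    by (simp add: w_def mult_ac)
  have xx: "x^2 * (a - d * y^2) = (1 + y) * w"
    using E by (simp add: w_def algebra_simps power2_eq_square)
  then have ady: "a - d * y^2 \<noteq> 0"
    using nz w by (metis mult_eq_0_iff)
  have "(2 * v)^2 = (a - d)^2 * (1 + y)^2 * (a - d * y^2) / (4 * w^2 * (x^2 * (a - d * y^2)))"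
    unfolding v2 using nz w num two ady by (simp add: power_divide power_mult_distrib)
  also have "\<dots> = (a - d)^2 * (1 + y) * (a - d * y^2) / (4 * w^3)"
  proof -
    have "K * S^2 * T / (4 * w^2 * (S * w)) = K * S * T / (4 * w^3)" if "S \<noteq> 0" for K S T :: 'f
      using that w num by (simp add: field_simps power2_eq_square power3_eq_cube)
    then show ?thesis unfolding xx using nz(3) .
  qed
  finally have vv: "(2 * v)^2 = (a - d)^2 * (1 + y) * (a - d * y^2) / (4 * w^3)" .
  have u: "u = ((5 * a - d) + (a - 5 * d) * y) / (12 * w)"
    and c: "c = (a - d)^3 * (a + 2 * a * y - 2 * d * y^3 - d * y^4) / (16 * w^4)"
    and g: "g = (a - d) * (2 * a + (a - d) * y - 2 * d * y^2) / (2 * w^2)"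
    unfolding u_def c_def g_def w_def[symmetric] by (simp_all add: power_mult_distrib)
  have "6 * u^2 + 2 * edwards_wA a d =
      (((5 * a - d) + (a - 5 * d) * y)^2 - (a^2 + 14 * a * d + d^2) * w^2) / (24 * w^2)"
  proof -
    have "6 * (K / (12 * w))^2 + 2 * (- (Y / 48)) = (K^2 - Y * w^2) / (24 * w^2)" for K Y :: 'f
      using num w by (simp add: field_simps power2_eq_square)
    then show ?thesis unfolding u edwards_wA_def by blast
  qed
  also have "((5 * a - d) + (a - 5 * d) * y)^2 - (a^2 + 14 * a * d + d^2) * w^2 =
      12 * ((a - d) * (2 * a + (a - d) * y - 2 * d * y^2))"
    unfolding w_def by (simp add: algebra_simps power2_eq_square)
  also have "12 * ((a - d) * (2 * a + (a - d) * y - 2 * d * y^2)) / (24 * w^2) = g"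
  proof -
    have "12 * K / (24 * w^2) = K / (2 * w^2)" for K :: 'f
      using num w two by (simp add: field_simps)
    then show ?thesis unfolding g .
  qed
  finally show "g = 6 * u^2 + 2 * edwards_wA a d" by simp
  have "48 * u * v^2 = 12 * u * (2 * v)^2"
    by (simp add: power_mult_distrib)
  also have "\<dots> = (a - d)^2 * (((5 * a - d) + (a - 5 * d) * y) * (1 + y) * (a - d * y^2)) / (4 * w^4)"
  proof -
    have "12 * (K / (12 * w)) * (Y * Z * W / (4 * w^3)) = Y * (K * Z * W) / (4 * w^4)" for K Y Z W :: 'f
      using num w by (simp add: field_simps power_numeral_reduce)
    then show ?thesis unfolding u vv .
  qed
  also have "\<dots> - g^2 = (a - d)^2 * (((5 * a - d) + (a - 5 * d) * y) * (1 + y) * (a - d * y^2)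
       - (2 * a + (a - d) * y - 2 * d * y^2)^2) / (4 * w^4)"
  proof -
    have "K^2 * Y / (4 * w^4) - (K * Z / (2 * w^2))^2 = K^2 * (Y - Z^2) / (4 * w^4)" for K Y Z :: 'f
      using num w two by (simp add: field_simps power_numeral_reduce)
    then show ?thesis unfolding g .
  qed
  also have "((5 * a - d) + (a - 5 * d) * y) * (1 + y) * (a - d * y^2) - (2 * a + (a - d) * y - 2 * d * y^2)^2
     = (a - d) * (a + 2 * a * y - 2 * d * y^3 - d * y^4)"
    by (simp add: algebra_simps power_numeral_reduce)
  also have "(a - d)^2 * ((a - d) * (a + 2 * a * y - 2 * d * y^3 - d * y^4)) / (4 * w^4) = 4 * c"
  proof -
    have "K^2 * (K * Y) / (4 * w^4) = 4 * (K^3 * Y / (16 * w^4))" for K Y :: 'f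
      using num w by (simp add: field_simps power_numeral_reduce)
    then show ?thesis unfolding c .
  qed
  finally show "4 * c = 48 * u * v^2 - g^2" by simp
  have "(2 * v)^4 = ((2 * v)^2)^2"
    by (simp only: power_mult[symmetric]) simp
  then have "g * c - (2 * v)^4 = (a - d)^4 * ((2 * a + (a - d) * y - 2 * d * y^2) *
      (a + 2 * a * y - 2 * d * y^3 - d * y^4) - 2 * ((1 + y) * (a - d * y^2))^2) / (32 * w^6)"
  proof -
    have "(K * Y / (2 * w^2)) * (K^3 * Z / (16 * w^4)) - (K^2 * S * T / (4 * w^3))^2 =
        K^4 * (Y * Z - 2 * (S * T)^2) / (32 * w^6)" for K Y Z S T :: 'f
      using num w two by (simp add: field_simps power_numeral_reduce)
    then show ?thesis unfolding \<open>(2 * v)^4 = _\<close> vv g c .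
  qed
  also have "(2 * a + (a - d) * y - 2 * d * y^2) * (a + 2 * a * y - 2 * d * y^3 - d * y^4)
      - 2 * ((1 + y) * (a - d * y^2))^2 = (a - d) * (y * (a - d * y^4))"
    by (simp add: algebra_simps power_numeral_reduce)
  finally have "2 * v * (g * c - (2 * v)^4) =
      ((a - d) * (1 + y) / (2 * x * w)) * ((a - d)^4 * ((a - d) * (y * (a - d * y^4))) / (32 * w^6))"
    unfolding v2 by simp
  also have "\<dots> = 2 * (a - d)^6 * y * (1 + y) * (a - d * y^4) / (x * (2 * w)^7)"
  proof -
    have "(K * S / (2 * x * w)) * (K^4 * (K * (y * T)) / (32 * w^6)) = 2 * K^6 * y * S * T / (x * (2 * w)^7)"
      for K S T :: 'f
      using num w two nz by (simp add: field_simps power_numeral_reduce)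
    then show ?thesis .
  qed
  finally show "2 * v * (g * c - (2 * v)^4) =
      2 * (a - d)^6 * y * (1 + y) * (a - d * y^4) / (x * (2 * (1 - y))^7)"
    unfolding w_def .
qed

section \<open>Arithmetic of fractions over a domain\<close>

context domain
begin

lemma frac_class_eq_iff:
  assumes "p \<in> carrier R" "q \<in> carrier R - {\<zero>}" "r \<in> carrier R" "s \<in> carrier R - {\<zero>}"
  shows "frac_class R p q = frac_class R r s \<longleftrightarrow> p \<otimes> s = r \<otimes> q"
proof
  assume "frac_class R p q = frac_class R r s"
  moreover have "(p, q) \<in> frac_class R p q"
    using assms by (simp add: frac_class_def frac_rel_def)
  ultimately show "p \<otimes> s = r \<otimes> q"
    by (simp add: frac_class_def frac_rel_def)
next
  have sub: "frac_class R p q \<subseteq> frac_class R r s"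
    if "p \<in> carrier R" "q \<in> carrier R - {\<zero>}" "r \<in> carrier R" "s \<in> carrier R - {\<zero>}" "p \<otimes> s = r \<otimes> q"
    for p q r s
  proof (intro subsetI)
    fix z assume "z \<in> frac_class R p q"
    then obtain x y where z: "z = (x, y)" and xy: "x \<in> carrier R" "y \<in> carrier R - {\<zero>}" "p \<otimes> y = x \<otimes> q"
      by (auto simp: frac_class_def frac_rel_def)
    have "(r \<otimes> y) \<otimes> q = (r \<otimes> q) \<otimes> y"
      using that(1-4) xy(1,2) by (simp add: m_ac)
    also have "\<dots> = (p \<otimes> y) \<otimes> s"
      unfolding that(5)[symmetric] using that(1-4) xy(1,2) by (simp add: m_ac)
    also have "\<dots> = (x \<otimes> s) \<otimes> q"
      unfolding xy(3) using that(1-4) xy(1,2) by (simp add: m_ac)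
    finally have "r \<otimes> y = x \<otimes> s"
      using that(1-4) xy(1,2) by (subst (asm) m_rcancel) auto
    then show "z \<in> frac_class R r s"
      using that xy by (simp add: z frac_class_def frac_rel_def)
  qed
  assume "p \<otimes> s = r \<otimes> q"
  then show "frac_class R p q = frac_class R r s"
    using sub[of p q r s] sub[of r s p q] assms by simp
qed

lemma frac_class_memD:
  assumes "(x, y) \<in> frac_class R p q"
  shows "x \<in> carrier R" "y \<in> carrier R - {\<zero>}" "p \<otimes> y = x \<otimes> q"
  using assms by (simp_all add: frac_class_def frac_rel_def)

lemma frac_class_self:
  assumes "p \<in> carrier R" "q \<in> carrier R - {\<zero>}"
  shows "(p, q) \<in> frac_class R p q"
  using assms by (simp add: frac_class_def frac_rel_def)

lemma denominator_mult:
  "q \<in> carrier R - {\<zero>} \<Longrightarrow> s \<in> carrier R - {\<zero>} \<Longrightarrow> q \<otimes> s \<in> carrier R - {\<zero>}"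
  by (auto simp: integral_iff)

text \<open>The operations of \<open>fraction_field\<close> are unions over all representatives. Such a union is the value
  at any one pair of representatives as soon as the operation does not depend on the choice.\<close>

lemma UN_frac_class:
  assumes pq: "p \<in> carrier R" "q \<in> carrier R - {\<zero>}" and rs: "r \<in> carrier R" "s \<in> carrier R - {\<zero>}"
    and const: "\<And>x y z w. (x, y) \<in> frac_class R p q \<Longrightarrow> (z, w) \<in> frac_class R r s \<Longrightarrow> f x y z w = f p q r s"
  shows "(\<Union>(x, y)\<in>frac_class R p q. \<Union>(z, w)\<in>frac_class R r s. f x y z w) = f p q r s"
proof -
  have "(\<Union>(x, y)\<in>frac_class R p q. \<Union>(z, w)\<in>frac_class R r s. f x y z w) =
      (\<Union>(x, y)\<in>frac_class R p q. \<Union>(z, w)\<in>frac_class R r s. f p q r s)"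
    by (intro SUP_cong refl) (auto dest: const)
  also have "\<dots> = f p q r s"
    using frac_class_self[OF pq] frac_class_self[OF rs] by auto
  finally show ?thesis .
qed

lemma fraction_field_mult:
  assumes pq: "p \<in> carrier R" "q \<in> carrier R - {\<zero>}" and rs: "r \<in> carrier R" "s \<in> carrier R - {\<zero>}"
  shows "frac_class R p q \<otimes>\<^bsub>fraction_field R\<^esub> frac_class R r s = frac_class R (p \<otimes> r) (q \<otimes> s)"
  unfolding fraction_field_def monoid.simps
proof (rule UN_frac_class[OF assms])
  fix x y z w
  assume "(x, y) \<in> frac_class R p q" and "(z, w) \<in> frac_class R r s"
  note xy = frac_class_memD[OF this(1)] and zw = frac_class_memD[OF this(2)]
  have "(x \<otimes> z) \<otimes> (q \<otimes> s) = (x \<otimes> q) \<otimes> (z \<otimes> s)"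
    using xy(1,2) zw(1,2) pq rs by (simp add: m_ac)
  also have "\<dots> = (p \<otimes> r) \<otimes> (y \<otimes> w)"
    unfolding xy(3)[symmetric] zw(3)[symmetric] using xy(1,2) zw(1,2) pq rs by (simp add: m_ac)
  finally show "frac_class R (x \<otimes> z) (y \<otimes> w) = frac_class R (p \<otimes> r) (q \<otimes> s)"
    using xy(1,2) zw(1,2) pq rs by (subst frac_class_eq_iff) (auto intro!: denominator_mult simp del: Diff_iff)
qed

lemma fraction_field_add:
  assumes pq: "p \<in> carrier R" "q \<in> carrier R - {\<zero>}" and rs: "r \<in> carrier R" "s \<in> carrier R - {\<zero>}"
  shows "frac_class R p q \<oplus>\<^bsub>fraction_field R\<^esub> frac_class R r s =
    frac_class R (p \<otimes> s \<oplus> r \<otimes> q) (q \<otimes> s)"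
  unfolding fraction_field_def ring.simps
proof (rule UN_frac_class[OF assms])
  fix x y z w
  assume "(x, y) \<in> frac_class R p q" and "(z, w) \<in> frac_class R r s"
  note xy = frac_class_memD[OF this(1)] and zw = frac_class_memD[OF this(2)]
  have "(x \<otimes> w \<oplus> z \<otimes> y) \<otimes> (q \<otimes> s) = (x \<otimes> q) \<otimes> (w \<otimes> s) \<oplus> (z \<otimes> s) \<otimes> (y \<otimes> q)"
    using xy(1,2) zw(1,2) pq rs by (simp add: m_ac l_distr r_distr)
  also have "\<dots> = (p \<otimes> s \<oplus> r \<otimes> q) \<otimes> (y \<otimes> w)"
    unfolding xy(3)[symmetric] zw(3)[symmetric] using xy(1,2) zw(1,2) pq rs by (simp add: m_ac l_distr r_distr)
  finally show "frac_class R (x \<otimes> w \<oplus> z \<otimes> y) (y \<otimes> w) = frac_class R (p \<otimes> s \<oplus> r \<otimes> q) (q \<otimes> s)"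
    using xy(1,2) zw(1,2) pq rs by (subst frac_class_eq_iff) (auto intro!: denominator_mult simp del: Diff_iff)
qed

lemma fraction_field_carrier:
  "carrier (fraction_field R) = {frac_class R p q | p q. p \<in> carrier R \<and> q \<in> carrier R - {\<zero>}}"
  by (auto simp: fraction_field_def quotient_def frac_class_def)

lemma fraction_field_one: "\<one>\<^bsub>fraction_field R\<^esub> = frac_class R \<one> \<one>"
  and fraction_field_zero: "\<zero>\<^bsub>fraction_field R\<^esub> = frac_class R \<zero> \<one>"
  by (simp_all add: fraction_field_def)

text \<open>The inverse in a structure is defined by a definite description, so uniqueness is part of the claim.
  It is checked on representatives.\<close>

lemma fraction_field_inv:
  assumes pq: "p \<in> carrier R - {\<zero>}" "q \<in> carrier R - {\<zero>}"
  shows "inv\<^bsub>fraction_field R\<^esub> (frac_class R p q) = frac_class R q p"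
  unfolding m_inv_def
proof (rule the_equality)
  have one: "\<one> \<in> carrier R - {\<zero>}" by simp
  have "frac_class R (p \<otimes> q) (q \<otimes> p) = frac_class R \<one> \<one>"
    using pq one denominator_mult[OF pq(2,1)] by (subst frac_class_eq_iff) (auto simp: m_comm)
  moreover have "frac_class R (q \<otimes> p) (p \<otimes> q) = frac_class R \<one> \<one>"
    using pq one denominator_mult[OF pq] by (subst frac_class_eq_iff) (auto simp: m_comm)
  ultimately show "frac_class R q p \<in> carrier (fraction_field R) \<and>
      frac_class R p q \<otimes>\<^bsub>fraction_field R\<^esub> frac_class R q p = \<one>\<^bsub>fraction_field R\<^esub> \<and>
      frac_class R q p \<otimes>\<^bsub>fraction_field R\<^esub> frac_class R p q = \<one>\<^bsub>fraction_field R\<^esub>"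
    using pq by (auto simp: fraction_field_mult fraction_field_one fraction_field_carrier)
  fix t assume "t \<in> carrier (fraction_field R) \<and>
      frac_class R p q \<otimes>\<^bsub>fraction_field R\<^esub> t = \<one>\<^bsub>fraction_field R\<^esub> \<and>
      t \<otimes>\<^bsub>fraction_field R\<^esub> frac_class R p q = \<one>\<^bsub>fraction_field R\<^esub>"
  then obtain r s where t: "t = frac_class R r s" and rs: "r \<in> carrier R" "s \<in> carrier R - {\<zero>}"
    and "frac_class R p q \<otimes>\<^bsub>fraction_field R\<^esub> t = \<one>\<^bsub>fraction_field R\<^esub>"
    unfolding fraction_field_carrier by blast
  then have "frac_class R (p \<otimes> r) (q \<otimes> s) = frac_class R \<one> \<one>"
    unfolding t fraction_field_one using pq by (subst (asm) fraction_field_mult) auto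
  then have "(p \<otimes> r) \<otimes> \<one> = \<one> \<otimes> (q \<otimes> s)"
    using pq rs one denominator_mult[OF pq(2) rs(2)] by (subst (asm) frac_class_eq_iff) auto
  then have "r \<otimes> p = q \<otimes> s"
    using pq rs by (simp add: m_comm)
  then show "t = frac_class R q p"
    unfolding t using pq rs by (subst frac_class_eq_iff) auto
qed

lemma fraction_field_minus:
  assumes pq: "p \<in> carrier R" "q \<in> carrier R - {\<zero>}"
  shows "\<ominus>\<^bsub>fraction_field R\<^esub> (frac_class R p q) = frac_class R (\<ominus> p) q"
  unfolding a_inv_def[of "fraction_field R"] m_inv_def[of "add_monoid (fraction_field R)"]
proof (rule the_equality)
  have one: "\<one> \<in> carrier R - {\<zero>}" by simp
  have "frac_class R (p \<otimes> q \<oplus> \<ominus> p \<otimes> q) (q \<otimes> q) = frac_class R \<zero> \<one>"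
    using pq one denominator_mult[OF pq(2,2)] by (subst frac_class_eq_iff) (auto simp: l_minus r_neg)
  moreover have "frac_class R (\<ominus> p \<otimes> q \<oplus> p \<otimes> q) (q \<otimes> q) = frac_class R \<zero> \<one>"
    using pq one denominator_mult[OF pq(2,2)] by (subst frac_class_eq_iff) (auto simp: l_minus l_neg)
  ultimately show "frac_class R (\<ominus> p) q \<in> carrier (add_monoid (fraction_field R)) \<and>
      frac_class R p q \<otimes>\<^bsub>add_monoid (fraction_field R)\<^esub> frac_class R (\<ominus> p) q = \<one>\<^bsub>add_monoid (fraction_field R)\<^esub> \<and>
      frac_class R (\<ominus> p) q \<otimes>\<^bsub>add_monoid (fraction_field R)\<^esub> frac_class R p q = \<one>\<^bsub>add_monoid (fraction_field R)\<^esub>"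
    using pq by (auto simp: fraction_field_add fraction_field_zero fraction_field_carrier)
  fix t assume "t \<in> carrier (add_monoid (fraction_field R)) \<and>
      frac_class R p q \<otimes>\<^bsub>add_monoid (fraction_field R)\<^esub> t = \<one>\<^bsub>add_monoid (fraction_field R)\<^esub> \<and>
      t \<otimes>\<^bsub>add_monoid (fraction_field R)\<^esub> frac_class R p q = \<one>\<^bsub>add_monoid (fraction_field R)\<^esub>"
  then have "t \<in> carrier (fraction_field R)" and sum: "frac_class R p q \<oplus>\<^bsub>fraction_field R\<^esub> t = \<zero>\<^bsub>fraction_field R\<^esub>"
    by simp_all
  then obtain r s where t: "t = frac_class R r s" and rs: "r \<in> carrier R" "s \<in> carrier R - {\<zero>}"
    unfolding fraction_field_carrier by blast
  have "(p \<otimes> s \<oplus> r \<otimes> q) \<otimes> \<one> = \<zero> \<otimes> (q \<otimes> s)"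
    using sum pq rs one denominator_mult[OF pq(2) rs(2)]
    unfolding t fraction_field_zero fraction_field_add[OF pq rs] by (subst (asm) frac_class_eq_iff) auto
  then have "r \<otimes> q \<oplus> p \<otimes> s = \<zero>"
    using pq rs by (simp add: a_comm)
  then have "\<ominus> (p \<otimes> s) = r \<otimes> q"
    using pq rs by (intro minus_equality) auto
  then have "r \<otimes> q = \<ominus> p \<otimes> s"
    using pq rs by (simp add: l_minus)
  then show "t = frac_class R (\<ominus> p) q"
    unfolding t using pq rs by (subst frac_class_eq_iff) auto
qed

end

section \<open>Values of elements of the function field\<close>

lemma type_algebra_simps:
  "carrier ring_of_type_algebra = UNIV"
  "p \<otimes>\<^bsub>ring_of_type_algebra\<^esub> q = p * q"
  "p \<oplus>\<^bsub>ring_of_type_algebra\<^esub> q = p + q"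
  "\<one>\<^bsub>ring_of_type_algebra\<^esub> = 1"
  "\<zero>\<^bsub>ring_of_type_algebra\<^esub> = 0"
  for p q :: "'a::comm_ring_1"
  by (simp_all add: ring_of_type_algebra_def)

lemma edwards_ideal_eq: "edwards_ideal a d = {p. edwards_poly a d dvd p}"
proof -
  interpret cring "ring_of_type_algebra :: 'a poly poly ring"
    by (rule cring_from_type_algebra)
  show ?thesis
    unfolding edwards_ideal_def
    by (subst cgenideal_eq_genideal[symmetric])
      (auto simp: cgenideal_def type_algebra_simps dvd_def mult.commute)
qed

locale edwards_function_field =
  fixes a d :: "'k::field"
  assumes two: "(2::'k) \<noteq> 0" and a_nonzero: "a \<noteq> 0" and a_neq_d: "a \<noteq> d"
begin

abbreviation coset :: "'k poly poly \<Rightarrow> 'k poly poly set" where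
  "coset p \<equiv> edwards_ideal a d +>\<^bsub>ring_of_type_algebra\<^esub> p"

sublocale R: cring "ring_of_type_algebra :: 'k poly poly ring"
  by (rule cring_from_type_algebra)

sublocale I: primeideal "edwards_ideal a d" "ring_of_type_algebra :: 'k poly poly ring"
proof (rule primeidealI)
  show "ideal (edwards_ideal a d) (ring_of_type_algebra :: 'k poly poly ring)"
    unfolding edwards_ideal_def by (rule R.genideal_ideal) (simp add: type_algebra_simps)
  have "\<not> edwards_poly a d dvd 1"
  proof
    assume "edwards_poly a d dvd 1"
    then have "degree (edwards_poly a d) \<le> degree (1 :: 'k poly poly)"
      by (rule dvd_imp_degree_le) simp
    then show False by (simp add: edwards_poly_altdef)
  qed
  then show "carrier ring_of_type_algebra \<noteq> edwards_ideal a d"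
    by (auto simp: edwards_ideal_eq type_algebra_simps)
  show "p \<in> edwards_ideal a d \<or> q \<in> edwards_ideal a d"
    if "p \<otimes>\<^bsub>ring_of_type_algebra\<^esub> q \<in> edwards_ideal a d" for p q
    using edwards_poly_prime[OF two a_nonzero a_neq_d, of p q] that
    by (simp add: edwards_ideal_eq type_algebra_simps)
qed (rule R.is_cring)

sublocale C: domain "coord_ring a d"
  unfolding coord_ring_def by (rule I.quotient_is_domain)

lemma coset_hom: "ring_hom_cring ring_of_type_algebra (coord_ring a d) coset"
  unfolding coord_ring_def by (rule I.rcos_ring_hom_cring)

sublocale h: ring_hom_cring "ring_of_type_algebra :: 'k poly poly ring" "coord_ring a d" coset
  by (rule coset_hom)

lemma coset_closed: "coset p \<in> carrier (coord_ring a d)"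
  using h.hom_closed by (simp add: type_algebra_simps)

lemma coset_mult: "coset p \<otimes>\<^bsub>coord_ring a d\<^esub> coset q = coset (p * q)"
  using h.hom_mult[of p q] by (simp add: type_algebra_simps)

lemma coset_add: "coset p \<oplus>\<^bsub>coord_ring a d\<^esub> coset q = coset (p + q)"
  using h.hom_add[of p q] by (simp add: type_algebra_simps)

lemma coset_one: "\<one>\<^bsub>coord_ring a d\<^esub> = coset 1"
  using h.hom_one by (simp add: type_algebra_simps)

lemma coset_zero: "\<zero>\<^bsub>coord_ring a d\<^esub> = coset 0"
  using h.hom_zero by (simp add: type_algebra_simps)

lemma coset_minus: "\<ominus>\<^bsub>coord_ring a d\<^esub> coset p = coset (- p)"
  by (rule C.minus_equality) (simp_all add: coset_add coset_zero coset_closed)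

lemma coset_eq_iff: "coset p = coset q \<longleftrightarrow> edwards_poly a d dvd p - q"
proof -
  have "\<ominus>\<^bsub>ring_of_type_algebra\<^esub> q = - q"
    by (rule R.minus_equality) (simp_all add: type_algebra_simps)
  then have "p \<ominus>\<^bsub>ring_of_type_algebra\<^esub> q = p - q"
    by (simp add: a_minus_def type_algebra_simps)
  then have "coset p = coset q \<longleftrightarrow> p - q \<in> edwards_ideal a d"
    using R.quotient_eq_iff_same_a_r_cos[OF I.is_ideal, of p q] by (simp add: type_algebra_simps)
  then show ?thesis
    by (simp add: edwards_ideal_eq)
qed

lemma coset_denominator:
  "\<not> edwards_poly a d dvd q \<Longrightarrow> coset q \<in> carrier (coord_ring a d) - {\<zero>\<^bsub>coord_ring a d\<^esub>}"
  by (simp add: coset_closed coset_zero coset_eq_iff)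

lemma ff_quot_eq_iff:
  assumes "\<not> edwards_poly a d dvd q" "\<not> edwards_poly a d dvd s"
  shows "ff_quot a d p q = ff_quot a d r s \<longleftrightarrow> edwards_poly a d dvd p * s - r * q"
  unfolding ff_quot_def
  by (subst C.frac_class_eq_iff) (simp_all add: coset_closed coset_denominator assms coset_mult coset_eq_iff del: Diff_iff)

lemma ff_quot_mult:
  assumes "\<not> edwards_poly a d dvd q" "\<not> edwards_poly a d dvd s"
  shows "ff_quot a d p q \<otimes>\<^bsub>function_field a d\<^esub> ff_quot a d r s = ff_quot a d (p * r) (q * s)"
  unfolding ff_quot_def function_field_def
  by (subst C.fraction_field_mult) (simp_all add: coset_closed coset_denominator assms coset_mult del: Diff_iff)

lemma ff_quot_add:
  assumes "\<not> edwards_poly a d dvd q" "\<not> edwards_poly a d dvd s"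
  shows "ff_quot a d p q \<oplus>\<^bsub>function_field a d\<^esub> ff_quot a d r s = ff_quot a d (p * s + r * q) (q * s)"
  unfolding ff_quot_def function_field_def
  by (subst C.fraction_field_add) (simp_all add: coset_closed coset_denominator assms coset_mult coset_add del: Diff_iff)

lemma ff_quot_minus:
  assumes "\<not> edwards_poly a d dvd q"
  shows "\<ominus>\<^bsub>function_field a d\<^esub> ff_quot a d p q = ff_quot a d (- p) q"
  unfolding ff_quot_def function_field_def
  by (subst C.fraction_field_minus) (simp_all add: coset_closed coset_denominator assms coset_minus del: Diff_iff)

lemma ff_quot_inv:
  assumes "\<not> edwards_poly a d dvd p" "\<not> edwards_poly a d dvd q"
  shows "inv\<^bsub>function_field a d\<^esub> ff_quot a d p q = ff_quot a d q p"
  unfolding ff_quot_def function_field_def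
  by (subst C.fraction_field_inv) (simp_all add: coset_denominator assms del: Diff_iff)

lemma ff_quot_one: "\<one>\<^bsub>function_field a d\<^esub> = ff_quot a d 1 1"
  and ff_quot_zero: "\<zero>\<^bsub>function_field a d\<^esub> = ff_quot a d 0 1"
  unfolding ff_quot_def function_field_def
  by (simp_all add: C.fraction_field_one C.fraction_field_zero coset_one coset_zero)

end

lemma eval_ac_hom: "type_ring_hom (\<lambda>p. eval_ac p P)"
  unfolding eval_ac_def by (intro type_ring_hom.poly_map_hom to_ac_type_ring_hom)

lemma eval_ac_generators:
  "eval_ac (polyC c) P = to_ac c" "eval_ac polyX P = fst P" "eval_ac polyY P = snd P"
  by (simp_all add: eval_ac_def polyC_def polyX_def polyY_def map_poly_pCons)

locale edwards_curve_point = edwards_function_field a d for a d :: "'k::field" +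
  fixes P :: "'k alg_closure \<times> 'k alg_closure"
  assumes on_curve: "P \<in> edwards_curve (to_ac a) (to_ac d)"
begin

sublocale ev: type_ring_hom "\<lambda>p. eval_ac p P"
  by (rule eval_ac_hom)

lemmas eval_simps = ev.hom_simps ev.hom_numeral eval_ac_generators

text \<open>Evaluation at a point of the curve factors through the coordinate ring. In particular a
  denominator that does not vanish at \<open>P\<close> is not zero in the coordinate ring.\<close>

lemma eval_edwards_poly_dvd: "edwards_poly a d dvd p \<Longrightarrow> eval_ac p P = 0"
proof (elim dvdE)
  fix q assume "p = edwards_poly a d * q"
  moreover have "eval_ac (edwards_poly a d) P = 0"
    using on_curve by (simp add: edwards_poly_def eval_simps edwards_curve_def case_prod_beta)
  ultimately show ?thesis by (simp add: eval_simps)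
qed

lemma not_dvd: "eval_ac q P \<noteq> 0 \<Longrightarrow> \<not> edwards_poly a d dvd q"
  using eval_edwards_poly_dvd by blast

definition has_value where
  "has_value \<phi> z \<longleftrightarrow> (\<exists>p q. \<phi> = ff_quot a d p q \<and> eval_ac q P \<noteq> 0 \<and> z = eval_ac p P / eval_ac q P)"

lemma has_valueI:
  "eval_ac q P \<noteq> 0 \<Longrightarrow> z = eval_ac p P / eval_ac q P \<Longrightarrow> has_value (ff_quot a d p q) z"
  by (auto simp: has_value_def)

lemma has_valueE:
  assumes "has_value \<phi> z"
  obtains p q where "\<phi> = ff_quot a d p q" "eval_ac q P \<noteq> 0" "z = eval_ac p P / eval_ac q P"
    "\<not> edwards_poly a d dvd q"
  using assms not_dvd by (auto simp: has_value_def)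

text \<open>Two representations of the same element have cross products that differ by a multiple of the
  Edwards polynomial, so they have equal values. Hence the definite description is determined by
  any one representation.\<close>

lemma ff_value_eq:
  assumes "has_value \<phi> z"
  shows "ff_value a d \<phi> P = z"
  unfolding ff_value_def
proof (rule the_equality)
  show "\<exists>p q. \<phi> = ff_quot a d p q \<and> eval_ac q P \<noteq> 0 \<and> z = eval_ac p P / eval_ac q P"
    using assms by (simp add: has_value_def)
  fix w assume "\<exists>p q. \<phi> = ff_quot a d p q \<and> eval_ac q P \<noteq> 0 \<and> w = eval_ac p P / eval_ac q P"
  then obtain r s where rs: "\<phi> = ff_quot a d r s" "eval_ac s P \<noteq> 0" "w = eval_ac r P / eval_ac s P"
    by blast
  obtain p q where pq: "\<phi> = ff_quot a d p q" "eval_ac q P \<noteq> 0" "z = eval_ac p P / eval_ac q P"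
    using has_valueE[OF assms] .
  have "ff_quot a d p q = ff_quot a d r s"
    using pq(1) rs(1) by simp
  then have "edwards_poly a d dvd p * s - r * q"
    by (rule iffD1[OF ff_quot_eq_iff[OF not_dvd not_dvd, OF pq(2) rs(2)]])
  then have "eval_ac (p * s - r * q) P = 0"
    by (rule eval_edwards_poly_dvd)
  then have "eval_ac p P * eval_ac s P = eval_ac r P * eval_ac q P"
    by (simp add: eval_simps)
  then show "w = z"
    unfolding pq(3) rs(3) using pq(2) rs(2) by (simp add: frac_eq_eq)
qed

lemma has_value_one: "has_value \<one>\<^bsub>function_field a d\<^esub> 1"
  and has_value_zero: "has_value \<zero>\<^bsub>function_field a d\<^esub> 0"
  by (auto simp: ff_quot_one ff_quot_zero eval_simps intro!: has_valueI)

lemma has_value_mult: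
  assumes "has_value \<phi> z" "has_value \<chi> w"
  shows "has_value (\<phi> \<otimes>\<^bsub>function_field a d\<^esub> \<chi>) (z * w)"
  using assms by (elim has_valueE) (auto simp: ff_quot_mult eval_simps intro!: has_valueI)

lemma has_value_minus:
  assumes "has_value \<phi> z" "has_value \<chi> w"
  shows "has_value (\<phi> \<ominus>\<^bsub>function_field a d\<^esub> \<chi>) (z - w)"
proof -
  obtain p q where pq: "\<phi> = ff_quot a d p q" "eval_ac q P \<noteq> 0" "z = eval_ac p P / eval_ac q P"
    "\<not> edwards_poly a d dvd q"
    using assms(1) by (rule has_valueE)
  obtain r s where rs: "\<chi> = ff_quot a d r s" "eval_ac s P \<noteq> 0" "w = eval_ac r P / eval_ac s P"
    "\<not> edwards_poly a d dvd s"
    using assms(2) by (rule has_valueE)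
  have "\<phi> \<ominus>\<^bsub>function_field a d\<^esub> \<chi> = ff_quot a d (p * s + - r * q) (q * s)"
    unfolding a_minus_def pq(1) rs(1) ff_quot_minus[OF rs(4)] ff_quot_add[OF pq(4) rs(4)] ..
  moreover have "z - w = eval_ac (p * s + - r * q) P / eval_ac (q * s) P"
    unfolding pq(3) rs(3) using pq(2) rs(2) by (simp add: eval_simps field_simps)
  ultimately show ?thesis
    using pq(2) rs(2) by (auto simp: eval_simps intro!: has_valueI)
qed

lemma has_value_inv:
  assumes "has_value \<phi> z" "z \<noteq> 0"
  shows "has_value (inv\<^bsub>function_field a d\<^esub> \<phi>) (inverse z)"
  using assms
  by (elim has_valueE) (auto simp: ff_quot_inv not_dvd intro!: has_valueI)

lemma has_value_power:
  assumes "has_value \<phi> z"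
  shows "has_value (\<phi> [^]\<^bsub>function_field a d\<^esub> (n::nat)) (z ^ n)"
proof (induction n)
  case 0
  then show ?case using has_value_one by (simp add: nat_pow_def)
next
  case (Suc n)
  then show ?case
    using has_value_mult[OF Suc.IH assms] by (simp add: nat_pow_def mult.commute)
qed

text \<open>The values of all \<open>psi a d n\<close> are computed by the same recursion. At the even indices this uses that
  the value \<open>b\<close> of \<open>psi a d 2\<close> is not zero, which holds as \<open>1 + y\<close> is not zero.\<close>

lemma has_value_psi:
  assumes nz: "fst P \<noteq> 0" "1 - snd P \<noteq> 0" "1 + snd P \<noteq> 0"
  defines "x \<equiv> fst P" and "y \<equiv> snd P" and "A \<equiv> to_ac a" and "D \<equiv> to_ac d"
  assumes b: "b = (A - D) * (1 + y) / (x * (2 * (1 - y)))"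
    and c: "c = (A - D)^3 * (A + 2 * A * y - 2 * D * y^3 - D * y^4) / (2 * (1 - y))^4"
    and e: "b * e = 2 * (A - D)^6 * y * (1 + y) * (A - D * y^4) / (x * (2 * (1 - y))^7)"
  shows "has_value (psi a d n) (eds b c e n)"
proof (induction n rule: less_induct)
  case (less n)
  have two': "(2::'k alg_closure) \<noteq> 0"
    using two to_ac_eq_0_iff[of "2::'k"] by simp
  have b0: "b \<noteq> 0"
    unfolding b x_def y_def A_def D_def using nz two' a_neq_d by simp
  have psi2: "has_value (psi a d 2) b"
    unfolding psi.simps(3) b x_def y_def A_def D_def using nz two'
    by (intro has_valueI) (simp_all add: eval_simps)
  have "n = 0 \<or> n = 1 \<or> n = 2 \<or> n = 3 \<or> n = 4 \<or> (\<exists>m\<ge>2. n = 2 * m + 1) \<or> (\<exists>m\<ge>3. n = 2 * m)"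
    by presburger
  then consider "n = 0" | "n = 1" | "n = 2" | "n = 3" | "n = 4"
    | m where "m \<ge> 2" "n = 2 * m + 1" | m where "m \<ge> 3" "n = 2 * m"
    by blast
  then show ?case
  proof cases
    case 1
    show ?thesis unfolding 1 psi.simps(1) eds_initial(1) by (rule has_value_zero)
  next
    case 2
    show ?thesis unfolding 2 psi.simps(2) eds_initial(2) by (rule has_value_one)
  next
    case 3
    show ?thesis unfolding 3 eds_initial(3) by (rule psi2)
  next
    case 4
    show ?thesis
      unfolding 4 psi.simps(4) eds_initial(4) c x_def y_def A_def D_def using nz two'
      by (intro has_valueI) (simp_all add: eval_simps)
  next
    case 5
    show ?thesis
      unfolding 5 psi.simps(5) eds_initial(5) e x_def y_def A_def D_def using nz two'
      by (intro has_valueI) (simp_all add: eval_simps)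
  next
    case 6
    have "has_value (psi a d j) (eds b c e j)" if "j \<in> {m - 1, m, m + 1, m + 2}" for j
      by (rule less.IH) (use 6 that in auto)
    then show ?thesis
      unfolding 6(2) psi.simps(6)[OF 6(1)] eds_odd[OF 6(1)]
      by (intro has_value_minus has_value_mult has_value_power) simp_all
  next
    case 7
    have IH: "has_value (psi a d j) (eds b c e j)" if "j \<in> {m - 2, m - 1, m, m + 1, m + 2}" for j
      by (rule less.IH) (use 7 that in auto)
    have eq: "eds b c e (2 * m) = eds b c e m * inverse b *
       (eds b c e (m + 2) * eds b c e (m - 1) ^ 2 - eds b c e (m - 2) * eds b c e (m + 1) ^ 2)"
      using eds_even[OF 7(1), of b c e] b0 by (simp add: field_simps)
    show ?thesis
      unfolding 7(2) psi.simps(7)[OF 7(1)] eq using IH psi2 b0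
      by (intro has_value_minus has_value_mult has_value_power has_value_inv) simp_all
  qed
qed

end

section \<open>Torsion points are the zeros of the division polynomials\<close>

theorem corollary5p2:
  fixes a d :: "'k::field" and P :: "'k alg_closure \<times> 'k alg_closure" and n :: nat
  assumes "CHAR('k) \<noteq> 2" and "CHAR('k) \<noteq> 3"
    and "a \<noteq> d" and "a \<noteq> 0" and "d \<noteq> 0"
    and "P \<in> edwards_curve (to_ac a) (to_ac d) - {(0, 1), (0, -1)}"
    and "n \<ge> 1"
  shows "edwards_torsion (to_ac a) (to_ac d) n P \<longleftrightarrow> ff_value a d (psi a d n) P = 0"
proof -
  have num: "(2::'k) \<noteq> 0" "(3::'k) \<noteq> 0"
  proof -
    have "of_nat p \<noteq> (0::'k)" if "Factorial_Ring.prime p" "CHAR('k) \<noteq> p" for p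
      using that CHAR_not_1'[where ?'a = 'k] by (auto simp: of_nat_eq_0_iff_char_dvd prime_nat_iff)
    from this[of 2] this[of 3] show "(2::'k) \<noteq> 0" "(3::'k) \<noteq> 0"
      using assms(1,2) by simp_all
  qed
  interpret edwards_curve_point a d P
    using assms num by unfold_locales auto
  obtain x y where P: "P = (x, y)" by (cases P)
  define A D where "A = to_ac a" and "D = to_ac d"
  have num': "(2::'k alg_closure) \<noteq> 0" "(3::'k alg_closure) \<noteq> 0"
    using num to_ac_eq_0_iff[of "2::'k"] to_ac_eq_0_iff[of "3::'k"] by simp_all
  have AD: "A \<noteq> D" "A \<noteq> 0" using assms by (simp_all add: A_def D_def)
  have E: "A * x^2 + y^2 = 1 + D * x^2 * y^2"
    using assms(6) by (simp add: P A_def D_def edwards_curve_def)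
  \<comment> \<open>The only points with \<open>x = 0\<close> or with \<open>y = 1\<close> or \<open>y = - 1\<close> are the two excluded ones.\<close>
  have x: "x \<noteq> 0"
  proof
    assume "x = 0"
    then have "y^2 = 1" using E by simp
    then show False using assms(6) \<open>x = 0\<close> by (simp add: P power2_eq_1_iff)
  qed
  have y: "y^2 \<noteq> 1"
  proof
    assume "y^2 = 1"
    then have "(A - D) * x^2 = 0" using E by (simp add: algebra_simps)
    then show False using x AD by simp
  qed
  then have y1: "1 - y \<noteq> 0" and y2: "1 + y \<noteq> 0"
    by (auto simp: power2_eq_1_iff eq_neg_iff_add_eq_0 add.commute)
  define u v c g where "u = ((5 * A - D) + (A - 5 * D) * y) / (12 * (1 - y))"
    and "v = ((A - D) * (1 + y)) / (4 * x * (1 - y))"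
    and "c = (A - D)^3 * (A + 2 * A * y - 2 * D * y^3 - D * y^4) / (2 * (1 - y))^4"
    and "g = (A - D) * (2 * A + (A - D) * y - 2 * D * y^2) / (2 * (1 - y)^2)"
  note vals = edwards_division_values[OF num' E x y1 y2 AD(1), folded u_def v_def c_def g_def]
  have "edwards_to_w A D P = Affine u v"
    using x y1 by (simp add: P edwards_to_w_def u_def v_def)
  then have "edwards_torsion A D n P \<longleftrightarrow> w_mult (edwards_wA A D) n (Affine u v) = Infinity"
    using on_curve by (simp add: edwards_torsion_def A_def D_def)
  also have "\<dots> \<longleftrightarrow> eds (2 * v) c (g * c - (2 * v)^4) n = 0"
    by (rule w_mult_eq_Infinity_iff_eds[OF num'(1) vals(1,2,3) \<open>n \<ge> 1\<close>])
  also have "eds (2 * v) c (g * c - (2 * v)^4) n = ff_value a d (psi a d n) P"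
    using has_value_psi[of "2 * v" c "g * c - (2 * v)^4" n] vals(4,5) x y1 y2
    by (intro ff_value_eq[symmetric]) (simp add: P A_def D_def c_def)
  finally show ?thesis unfolding A_def D_def .
qed

end
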